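(* Let $\Bbbk$ be a field of characteristic different from $2$. For any $n\ge 1$, $$\mathrm{Z}^2(E(n),\Bbbk)=\mathrm{B}^2(E(n),\Bbbk)\oplus \mathrm{I}(E(n),\Bbbk),$$ where $\mathrm{I}(E(n),\Bbbk)$ is the $\Bbbk$-linear span of the elements $gx_i\otimes x_l\in E(n)\otimes E(n)$ with $1\le i\le l\le n$.
   Context: $E(n)$ is the $2^{n+1}$-dimensional Hopf algebra over $\Bbbk$ generated as an algebra by $g,x_1,\dots,x_n$ with relations $g^2=1$, $x_i^2=0$, $gx_i=-x_ig$, $x_ix_j=-x_jx_i$ for all $i,j$, and with $\Delta(g)=g\otimes g$, $\Delta(x_i)=x_i\otimes 1+g\otimes x_i$, $\varepsilon(g)=1$, $\varepsilon(x_i)=0$, $S(g)=g$, $S(x_i)=-gx_i$. For a bialgebra $H$, define $b^1:H\to H\otimes H$, $b^1(a)=1\otimes a-\Delta(a)+a\otimes 1$, and $b^2:H\otimes H\to H\otimes H\otimes H$, $b^2(a\otimes b)=1\otimes a\otimes b-\Delta(a)\otimes b+a\otimes\Delta(b)-a\otimes b\otimes 1$. Then $\mathrm{Z}^2(H,\Bbbk)=\mathrm{Ker}(b^2)$ is the space of $2$-cocycles and $\mathrm{B}^2(H,\Bbbk)=\mathrm{Im}(b^1)$ the space of $2$-coboundaries. *)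

theory Defs
  imports "HOL-Computational_Algebra.Computational_Algebra"
begin

section \<open>Tensor products of vector spaces\<close>

text \<open>Vector spaces are those of \<^locale>\<open>vector_space\<close>: a type with an explicit scalar
  multiplication. As types cannot depend on a scalar multiplication, a tensor product of \<open>V\<close> and
  \<open>W\<close> is not a type constructor here but any space \<open>T\<close> with a universal bilinear map
  \<open>t: V \<times> W \<rightarrow> T\<close>. The locale axiom tests universality on bilinear forms only, since a locale
  cannot quantify over target types; the universal property for arbitrary targets is the lemma
  \<open>universal_property\<close> below.\<close>

definition bilinear_map ::
  "('k::field \<Rightarrow> 'v::ab_group_add \<Rightarrow> 'v) \<Rightarrow> ('k \<Rightarrow> 'w::ab_group_add \<Rightarrow> 'w) \<Rightarrow>
   ('k \<Rightarrow> 'u::ab_group_add \<Rightarrow> 'u) \<Rightarrow> ('v \<Rightarrow> 'w \<Rightarrow> 'u) \<Rightarrow> bool" where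
  "bilinear_map sV sW sU f \<longleftrightarrow>
     (\<forall>w. Vector_Spaces.linear sV sU (\<lambda>v. f v w)) \<and> (\<forall>v. Vector_Spaces.linear sW sU (f v))"

locale tensor_product =
  V: vector_space sV + W: vector_space sW + T: vector_space sT
  for sV :: "'k::field \<Rightarrow> 'v::ab_group_add \<Rightarrow> 'v"
  and sW :: "'k \<Rightarrow> 'w::ab_group_add \<Rightarrow> 'w"
  and sT :: "'k \<Rightarrow> 't::ab_group_add \<Rightarrow> 't" +
  fixes t :: "'v \<Rightarrow> 'w \<Rightarrow> 't"
  assumes bilinear: "bilinear_map sV sW sT t"
    and universal: "bilinear_map sV sW (*) f \<Longrightarrow>
      \<exists>!F. Vector_Spaces.linear sT (*) F \<and> (\<forall>v w. F (t v w) = f v w)"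

definition tensor_lift ::
  "('k::field \<Rightarrow> 't::ab_group_add \<Rightarrow> 't) \<Rightarrow> ('k \<Rightarrow> 'u::ab_group_add \<Rightarrow> 'u) \<Rightarrow>
   ('v \<Rightarrow> 'w \<Rightarrow> 't) \<Rightarrow> ('v \<Rightarrow> 'w \<Rightarrow> 'u) \<Rightarrow> 't \<Rightarrow> 'u" where
  "tensor_lift sT sU t f = (THE F. Vector_Spaces.linear sT sU F \<and> (\<forall>v w. F (t v w) = f v w))"

lemma vector_space_field: "vector_space ((*) :: 'k::field \<Rightarrow> 'k \<Rightarrow> 'k)"
  by unfold_locales (simp_all add: algebra_simps)

lemma bilinear_mapI:
  assumes "vector_space sV" "vector_space sW" "vector_space sU"
    and "\<And>v v' w. f (v + v') w = f v w + f v' w" "\<And>c v w. f (sV c v) w = sU c (f v w)"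
    and "\<And>v w w'. f v (w + w') = f v w + f v w'" "\<And>c v w. f v (sW c w) = sU c (f v w)"
  shows "bilinear_map sV sW sU f"
  using assms unfolding bilinear_map_def
  by (auto intro!: Vector_Spaces.linear.intro module_hom.intro module_hom_axioms.intro
      simp: module_iff_vector_space)

lemma bilinear_mapD:
  assumes "bilinear_map sV sW sU f"
  shows "f (v + v') w = f v w + f v' w" "f (sV c v) w = sU c (f v w)"
    "f v (w + w') = f v w + f v w'" "f v (sW c w) = sU c (f v w)"
proof -
  interpret L: Vector_Spaces.linear sV sU "\<lambda>v. f v w" for w
    using assms unfolding bilinear_map_def by blast
  interpret R: Vector_Spaces.linear sW sU "f v" for v
    using assms unfolding bilinear_map_def by blast
  show "f (v + v') w = f v w + f v' w" "f (sV c v) w = sU c (f v w)"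
    "f v (w + w') = f v w + f v w'" "f v (sW c w) = sU c (f v w)"
    by (rule L.add L.scale R.add R.scale)+
qed

lemma bilinear_map_eq_on_bases:
  assumes "bilinear_map sV sW sU f" "bilinear_map sV sW sU f'"
    and B: "module.span sV B = UNIV" and C: "module.span sW C = UNIV"
    and eq: "\<And>b c. b \<in> B \<Longrightarrow> c \<in> C \<Longrightarrow> f b c = f' b c"
  shows "f v w = f' v w"
proof -
  have l: "Vector_Spaces.linear sV sU (\<lambda>v. f v w)" "Vector_Spaces.linear sV sU (\<lambda>v. f' v w)"
    "Vector_Spaces.linear sW sU (f v)" "Vector_Spaces.linear sW sU (f' v)" for v w
    using assms(1,2) unfolding bilinear_map_def by auto
  interpret VU: vector_space_pair sV sU
    using l(1)[of undefined] unfolding Vector_Spaces.linear_def vector_space_pair_def by blast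
  interpret WU: vector_space_pair sW sU
    using l(3)[of undefined] unfolding Vector_Spaces.linear_def vector_space_pair_def by blast
  have "f b w = f' b w" if "b \<in> B" for b
    by (rule WU.linear_eq_on_span[OF l(3,4), of C]) (use eq that C in auto)
  then show ?thesis
    by (rule VU.linear_eq_on_span[OF l(1,2), of B]) (use B in auto)
qed

context tensor_product
begin

lemma span_range: "T.span {t v w |v w. True} = UNIV"
proof (rule ccontr)
  let ?S = "{t v w |v w. True}"
  assume "T.span ?S \<noteq> UNIV"
  then obtain z where z: "z \<notin> T.span ?S" by blast
  obtain B where B: "B \<subseteq> T.span ?S" "T.independent B" "T.span ?S \<subseteq> T.span B"
    using T.maximal_independent_subset by blast
  have zB: "z \<notin> T.span B"
    using z B(1) T.span_mono[of B "T.span ?S"] by (auto simp: T.span_span)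
  then have ind: "T.independent (insert z B)"
    using B(2) by (simp add: T.independent_insert)
  interpret K: vector_space "(*) :: 'k \<Rightarrow> 'k \<Rightarrow> 'k" by (rule vector_space_field)
  interpret P: vector_space_pair sT "(*) :: 'k \<Rightarrow> 'k \<Rightarrow> 'k" ..
  obtain F where F: "Vector_Spaces.linear sT (*) F"
    "\<forall>x\<in>insert z B. F x = (if x = z then 1 else 0 :: 'k)"
    using P.linear_independent_extend[OF ind, of "\<lambda>x. if x = z then 1 else 0"] by blast
  have zz: "z \<notin> B" using zB T.span_base by blast
  have 0: "Vector_Spaces.linear sT (*) (\<lambda>_. 0 :: 'k)" by (rule P.linear_zero)
  have "F x = 0" if "x \<in> T.span B" for x
    by (rule P.linear_eq_on_span[OF F(1) 0 _ that]) (use F(2) zz in auto)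
  then have F0: "F (t v w) = 0" for v w
    using B(3) T.span_base[of "t v w" ?S] by blast
  have "bilinear_map sV sW (*) (\<lambda>v w. 0 :: 'k)"
    unfolding bilinear_map_def
    by (auto intro!: vector_space_pair.linear_zero simp: vector_space_pair_def
        V.vector_space_axioms W.vector_space_axioms vector_space_field)
  from universal[OF this] have "F = (\<lambda>_. 0)" using F(1) F0 0 by auto
  then show False using F(2) by auto
qed

theorem universal_property:
  fixes sU :: "'k \<Rightarrow> 'u::ab_group_add \<Rightarrow> 'u"
  assumes U: "vector_space sU" and f: "bilinear_map sV sW sU f"
  shows "\<exists>!F. Vector_Spaces.linear sT sU F \<and> (\<forall>v w. F (t v w) = f v w)"
proof -
  interpret U: vector_space sU by (rule U)
  interpret P: vector_space_pair sT sU ..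
  let ?B = "V.extend_basis {}" and ?C = "W.extend_basis {}"
  have B: "V.independent ?B" "V.span ?B = UNIV"
    by (simp_all add: V.independent_extend_basis V.independent_empty)
  have C: "W.independent ?C" "W.span ?C = UNIV"
    by (simp_all add: W.independent_extend_basis W.independent_empty)
  define f0 where "f0 b c v w = V.representation ?B v b * W.representation ?C w c" for b c v w
  have "bilinear_map sV sW (*) (f0 b c)" for b c
    unfolding bilinear_map_def f0_def using B C
    by (auto intro!: Vector_Spaces.linear.intro module_hom.intro module_hom_axioms.intro
        V.vector_space_axioms W.vector_space_axioms vector_space_field
        V.module_axioms W.module_axioms vector_space_field[unfolded module_iff_vector_space[symmetric]]
        simp: V.representation_add V.representation_scale W.representation_add
        W.representation_scale algebra_simps)
  then have "\<exists>F. Vector_Spaces.linear sT (*) F \<and> (\<forall>v w. F (t v w) = f0 b c v w)" for b c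
    using universal by blast
  then obtain G where G: "\<And>b c. Vector_Spaces.linear sT (*) (G b c)"
    "\<And>b c v w. G b c (t v w) = f0 b c v w" by metis
  have f0: "f0 b c b' c' = (if b = b' \<and> c = c' then 1 else 0)" if "b' \<in> ?B" "c' \<in> ?C" for b c b' c'
    using that B C by (auto simp: f0_def V.representation_basis W.representation_basis)
  let ?p = "\<lambda>(b, c). t b c"
  have inj: "inj_on ?p (?B \<times> ?C)"
  proof (rule inj_onI, clarify)
    fix b c b' c' assume *: "b \<in> ?B" "c \<in> ?C" "b' \<in> ?B" "c' \<in> ?C" "t b c = t b' c'"
    then have "f0 b c b c = f0 b c b' c'" by (metis G(2))
    then show "b = b' \<and> c = c'" using * f0 by (auto split: if_splits)
  qed
  have ind: "T.independent (?p ` (?B \<times> ?C))"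
  proof (rule ccontr)
    assume "\<not> T.independent (?p ` (?B \<times> ?C))"
    then obtain y where y: "y \<in> ?p ` (?B \<times> ?C)" "y \<in> T.span (?p ` (?B \<times> ?C) - {y})"
      unfolding T.dependent_def by blast
    then obtain b c where bc: "b \<in> ?B" "c \<in> ?C" "y = t b c" by auto
    interpret K: vector_space "(*) :: 'k \<Rightarrow> 'k \<Rightarrow> 'k" by (rule vector_space_field)
    interpret Q: vector_space_pair sT "(*) :: 'k \<Rightarrow> 'k \<Rightarrow> 'k" ..
    have "G b c y = 0"
      by (rule Q.linear_eq_on_span[OF G(1) Q.linear_zero _ y(2)]) (use bc in \<open>auto simp: G(2) f0\<close>)
    then show False using bc by (simp add: G(2) f0)
  qed
  obtain F where F: "Vector_Spaces.linear sT sU F"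
    "\<forall>x\<in>?p ` (?B \<times> ?C). F x = (\<lambda>(b, c). f b c) (inv_into (?B \<times> ?C) ?p x)"
    using P.linear_independent_extend[OF ind,
        of "\<lambda>x. (\<lambda>(b, c). f b c) (inv_into (?B \<times> ?C) ?p x)"] by blast
  have Fbc: "F (t b c) = f b c" if "b \<in> ?B" "c \<in> ?C" for b c
  proof -
    have "(b, c) \<in> ?B \<times> ?C" using that by blast
    then have "F (?p (b, c)) = (\<lambda>(b, c). f b c) (inv_into (?B \<times> ?C) ?p (?p (b, c)))"
      using F(2) by (meson imageI)
    also have "inv_into (?B \<times> ?C) ?p (?p (b, c)) = (b, c)"
      by (rule inv_into_f_f[OF inj \<open>(b, c) \<in> ?B \<times> ?C\<close>])
    finally show ?thesis by simp
  qed
  have tl: "Vector_Spaces.linear sV sT (\<lambda>v. t v w)" "Vector_Spaces.linear sW sT (t v)" for v w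
    using bilinear unfolding bilinear_map_def by auto
  have "bilinear_map sV sW sU (\<lambda>v w. F (t v w))"
    unfolding bilinear_map_def
    using Vector_Spaces.linear_compose[OF tl(1) F(1)] Vector_Spaces.linear_compose[OF tl(2) F(1)]
    by (simp add: o_def)
  from bilinear_map_eq_on_bases[OF this f B(2) C(2) Fbc]
  have Ff: "F (t v w) = f v w" for v w .
  show ?thesis
  proof (rule ex1I[of _ F], use F(1) Ff in blast, rule ext)
    fix F' z assume F': "Vector_Spaces.linear sT sU F' \<and> (\<forall>v w. F' (t v w) = f v w)"
    show "F' z = F z"
      by (rule P.linear_eq_on_span[of F' F "{t v w |v w. True}"]) (use F' F(1) Ff span_range in auto)
  qed
qed

lemma tensor_lift:
  assumes "vector_space sU" "bilinear_map sV sW sU f"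
  shows linear_tensor_lift: "Vector_Spaces.linear sT sU (tensor_lift sT sU t f)"
    and tensor_lift_apply: "tensor_lift sT sU t f (t v w) = f v w"
  using theI'[OF universal_property[OF assms]] unfolding tensor_lift_def by auto

end


section \<open>Bialgebras, Hopf algebras and their cochain maps\<close>

locale unital_algebra = vector_space scale
  for scale :: "'k::field \<Rightarrow> 'a::ring_1 \<Rightarrow> 'a" +
  assumes scale_mult_left: "scale c (a * b) = scale c a * b"
    and scale_mult_right: "scale c (a * b) = a * scale c b"

text \<open>\<open>HH\<close> is \<open>H \<otimes> H\<close> with its tensor product algebra structure, and \<open>HHH\<close> is \<open>H \<otimes> H \<otimes> H\<close>, read as
  \<open>(H \<otimes> H) \<otimes> H\<close>. Hence \<open>tt a b\<close> is \<open>a \<otimes> b\<close>, and \<open>ttt w c\<close> is \<open>w \<otimes> c\<close> for \<open>w\<close> in \<open>H \<otimes> H\<close>, so that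
  \<open>ttt (tt a b) c\<close> is \<open>a \<otimes> b \<otimes> c\<close>.\<close>

locale algebra_tensor_powers =
  H: unital_algebra sH + HH: unital_algebra sHH +
  T2: tensor_product sH sH sHH tt + T3: tensor_product sHH sH sHHH ttt
  for sH :: "'k::field \<Rightarrow> 'h::ring_1 \<Rightarrow> 'h"
  and sHH :: "'k \<Rightarrow> 'hh::ring_1 \<Rightarrow> 'hh"
  and sHHH :: "'k \<Rightarrow> 'hhh::ab_group_add \<Rightarrow> 'hhh"
  and tt :: "'h \<Rightarrow> 'h \<Rightarrow> 'hh"
  and ttt :: "'hh \<Rightarrow> 'h \<Rightarrow> 'hhh" +
  assumes tt_mult: "tt a b * tt c d = tt (a * c) (b * d)"
    and tt_one: "tt 1 1 = 1"
begin

text \<open>The element \<open>a \<otimes> w\<close> of \<open>H \<otimes> H \<otimes> H\<close> for \<open>a\<close> in \<open>H\<close> and \<open>w\<close> in \<open>H \<otimes> H\<close>.\<close>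

definition ttt_left :: "'h \<Rightarrow> 'hh \<Rightarrow> 'hhh" where
  "ttt_left a = tensor_lift sHH sHHH tt (\<lambda>u v. ttt (tt a u) v)"

lemmas tt_simps = bilinear_mapD[OF T2.bilinear]
lemmas ttt_simps = bilinear_mapD[OF T3.bilinear]

lemma ttt_left_aux: "bilinear_map sH sH sHHH (\<lambda>u v. ttt (tt a u) v)"
  by (rule bilinear_mapI)
    (simp_all add: tt_simps ttt_simps H.vector_space_axioms T3.T.vector_space_axioms)

lemma ttt_left_tt [simp]: "ttt_left a (tt u v) = ttt (tt a u) v"
  unfolding ttt_left_def by (rule T2.tensor_lift_apply[OF T3.T.vector_space_axioms ttt_left_aux])

lemma ttt_left_linear: "Vector_Spaces.linear sHH sHHH (ttt_left a)"
  unfolding ttt_left_def by (rule T2.linear_tensor_lift[OF T3.T.vector_space_axioms ttt_left_aux])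

lemma linear_eq_on_tt:
  assumes "Vector_Spaces.linear sHH sHHH F" "Vector_Spaces.linear sHH sHHH G"
    and "\<And>u v. F (tt u v) = G (tt u v)"
  shows "F z = G z"
proof -
  interpret P: vector_space_pair sHH sHHH ..
  show ?thesis
    by (rule P.linear_eq_on_span[OF assms(1,2), of "{tt u v |u v. True}"])
      (use assms(3) T2.span_range in auto)
qed

lemma ttt_left_bilinear: "bilinear_map sH sHH sHHH ttt_left"
proof -
  interpret P: vector_space_pair sHH sHHH ..
  have add: "ttt_left (a + a') w = ttt_left a w + ttt_left a' w" for a a' w
    by (rule linear_eq_on_tt[OF ttt_left_linear
          P.linear_compose_add[OF ttt_left_linear ttt_left_linear]])
      (simp add: tt_simps ttt_simps)
  have scale: "ttt_left (sH c a) w = sHHH c (ttt_left a w)" for c a w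
    by (rule linear_eq_on_tt[OF ttt_left_linear P.linear_compose_scale_right[OF ttt_left_linear]])
      (simp add: tt_simps ttt_simps)
  show ?thesis
    using ttt_left_linear add scale
    by (intro bilinear_mapI)
      (simp_all add: H.vector_space_axioms HH.vector_space_axioms T3.T.vector_space_axioms
        P.linear_add P.linear_scale)
qed

end

locale bialgebra = algebra_tensor_powers sH sHH sHHH tt ttt
  for sH :: "'k::field \<Rightarrow> 'h::ring_1 \<Rightarrow> 'h"
  and sHH :: "'k \<Rightarrow> 'hh::ring_1 \<Rightarrow> 'hh"
  and sHHH :: "'k \<Rightarrow> 'hhh::ab_group_add \<Rightarrow> 'hhh"
  and tt :: "'h \<Rightarrow> 'h \<Rightarrow> 'hh"
  and ttt :: "'hh \<Rightarrow> 'h \<Rightarrow> 'hhh" +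
  fixes \<Delta> :: "'h \<Rightarrow> 'hh" and \<epsilon> :: "'h \<Rightarrow> 'k"
  assumes comult_linear: "Vector_Spaces.linear sH sHH \<Delta>"
    and comult_mult: "\<Delta> (a * b) = \<Delta> a * \<Delta> b"
    and comult_one: "\<Delta> 1 = 1"
    and counit_linear: "Vector_Spaces.linear sH (*) \<epsilon>"
    and counit_mult: "\<epsilon> (a * b) = \<epsilon> a * \<epsilon> b"
    and counit_one: "\<epsilon> 1 = 1"
    and coassoc: "tensor_lift sHH sHHH tt (\<lambda>a b. ttt (\<Delta> a) b) (\<Delta> h) =
                  tensor_lift sHH sHHH tt (\<lambda>a b. ttt_left a (\<Delta> b)) (\<Delta> h)"
    and counit_left: "tensor_lift sHH sH tt (\<lambda>a b. sH (\<epsilon> a) b) (\<Delta> h) = h"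
    and counit_right: "tensor_lift sHH sH tt (\<lambda>a b. sH (\<epsilon> b) a) (\<Delta> h) = h"
begin

definition b1 :: "'h \<Rightarrow> 'hh" where
  "b1 a = tt 1 a - \<Delta> a + tt a 1"

definition b2 :: "'hh \<Rightarrow> 'hhh" where
  "b2 = tensor_lift sHH sHHH tt
     (\<lambda>a b. ttt (tt 1 a) b - ttt (\<Delta> a) b + ttt_left a (\<Delta> b) - ttt (tt a b) 1)"

text \<open>The defining formula of \<open>b2\<close> is bilinear in \<open>(a, b)\<close>, so \<open>b2\<close> takes this value on
  \<open>a \<otimes> b\<close>.\<close>

lemma
  shows b2_linear: "Vector_Spaces.linear sHH sHHH b2"
    and b2_tt: "b2 (tt a b) =
      ttt (tt 1 a) b - ttt (\<Delta> a) b + ttt_left a (\<Delta> b) - ttt (tt a b) 1"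
proof -
  interpret D: Vector_Spaces.linear sH sHH \<Delta> by (rule comult_linear)
  have *: "bilinear_map sH sH sHHH
      (\<lambda>a b. ttt (tt 1 a) b - ttt (\<Delta> a) b + ttt_left a (\<Delta> b) - ttt (tt a b) 1)"
    by (rule bilinear_mapI)
      (simp_all add: H.vector_space_axioms T3.T.vector_space_axioms D.add D.scale tt_simps
        ttt_simps bilinear_mapD[OF ttt_left_bilinear] T3.T.scale_right_distrib
        T3.T.scale_right_diff_distrib)
  show "Vector_Spaces.linear sHH sHHH b2"
    unfolding b2_def by (rule T2.linear_tensor_lift[OF T3.T.vector_space_axioms *])
  show "b2 (tt a b) = ttt (tt 1 a) b - ttt (\<Delta> a) b + ttt_left a (\<Delta> b) - ttt (tt a b) 1"
    unfolding b2_def by (rule T2.tensor_lift_apply[OF T3.T.vector_space_axioms *])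
qed

definition Z2 :: "'hh set" where
  "Z2 = {z. b2 z = 0}"

definition B2 :: "'hh set" where
  "B2 = range b1"

end

locale hopf_algebra = bialgebra sH sHH sHHH tt ttt \<Delta> \<epsilon>
  for sH :: "'k::field \<Rightarrow> 'h::ring_1 \<Rightarrow> 'h"
  and sHH :: "'k \<Rightarrow> 'hh::ring_1 \<Rightarrow> 'hh"
  and sHHH :: "'k \<Rightarrow> 'hhh::ab_group_add \<Rightarrow> 'hhh"
  and tt :: "'h \<Rightarrow> 'h \<Rightarrow> 'hh"
  and ttt :: "'hh \<Rightarrow> 'h \<Rightarrow> 'hhh"
  and \<Delta> :: "'h \<Rightarrow> 'hh" and \<epsilon> :: "'h \<Rightarrow> 'k" +
  fixes S :: "'h \<Rightarrow> 'h"
  assumes antipode_linear: "Vector_Spaces.linear sH sH S"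
    and antipode_left: "tensor_lift sHH sH tt (\<lambda>a b. S a * b) (\<Delta> h) = sH (\<epsilon> h) 1"
    and antipode_right: "tensor_lift sHH sH tt (\<lambda>a b. a * S b) (\<Delta> h) = sH (\<epsilon> h) 1"


section \<open>The Hopf algebra \<open>E(n)\<close>\<close>

text \<open>The smallest unital subalgebra containing \<open>X\<close>.\<close>

definition generated_subalgebra ::
  "('k::field \<Rightarrow> 'a::ring_1 \<Rightarrow> 'a) \<Rightarrow> 'a set \<Rightarrow> 'a set" where
  "generated_subalgebra scale X =
     \<Inter>{A. module.subspace scale A \<and> 1 \<in> A \<and> (\<forall>a\<in>A. \<forall>b\<in>A. a * b \<in> A) \<and> X \<subseteq> A}"

text \<open>The relations allow at most \<open>2^(n+1)\<close> linearly independent monomials \<open>g^a x\<^sub>i\<^sub>1 \<cdots> x\<^sub>i\<^sub>k\<close>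
  (\<open>a \<le> 1\<close>, \<open>i\<^sub>1 < \<cdots> < i\<^sub>k\<close>), so prescribing the dimension excludes further relations, and the locale
  determines \<open>E(n)\<close> up to isomorphism. Only the values \<open>x 1, \<dots>, x n\<close> of \<open>x\<close> are relevant.\<close>

locale E_hopf_algebra = hopf_algebra sH sHH sHHH tt ttt \<Delta> \<epsilon> S
  for sH :: "'k::field \<Rightarrow> 'h::ring_1 \<Rightarrow> 'h"
  and sHH :: "'k \<Rightarrow> 'hh::ring_1 \<Rightarrow> 'hh"
  and sHHH :: "'k \<Rightarrow> 'hhh::ab_group_add \<Rightarrow> 'hhh"
  and tt :: "'h \<Rightarrow> 'h \<Rightarrow> 'hh"
  and ttt :: "'hh \<Rightarrow> 'h \<Rightarrow> 'hhh"
  and \<Delta> :: "'h \<Rightarrow> 'hh" and \<epsilon> :: "'h \<Rightarrow> 'k" and S :: "'h \<Rightarrow> 'h" +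
  fixes n :: nat and g :: 'h and x :: "nat \<Rightarrow> 'h"
  assumes dimension: "vector_space.dim sH (UNIV :: 'h set) = 2 ^ (n + 1)"
    and generated: "generated_subalgebra sH (insert g (x ` {1..n})) = UNIV"
    and g_square: "g ^ 2 = 1"
    and x_square: "i \<in> {1..n} \<Longrightarrow> x i ^ 2 = 0"
    and g_x: "i \<in> {1..n} \<Longrightarrow> g * x i = - (x i * g)"
    and x_x: "i \<in> {1..n} \<Longrightarrow> j \<in> {1..n} \<Longrightarrow> x i * x j = - (x j * x i)"
    and comult_g: "\<Delta> g = tt g g"
    and comult_x: "i \<in> {1..n} \<Longrightarrow> \<Delta> (x i) = tt (x i) 1 + tt g (x i)"
    and counit_g: "\<epsilon> g = 1"
    and counit_x: "i \<in> {1..n} \<Longrightarrow> \<epsilon> (x i) = 0"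
    and antipode_g: "S g = g"
    and antipode_x: "i \<in> {1..n} \<Longrightarrow> S (x i) = - (g * x i)"
begin

definition I2 :: "'hh set" where
  "I2 = module.span sHH {tt (g * x i) (x l) |i l. 1 \<le> i \<and> i \<le> l \<and> l \<le> n}"

end

text \<open>\<open>A = B \<oplus> C\<close> as subspaces of one ambient vector space.\<close>

definition internal_direct_sum ::
  "('k::field \<Rightarrow> 'v::ab_group_add \<Rightarrow> 'v) \<Rightarrow> 'v set \<Rightarrow> 'v set \<Rightarrow> 'v set \<Rightarrow> bool" where
  "internal_direct_sum scale A B C \<longleftrightarrow>
     module.subspace scale B \<and> module.subspace scale C \<and>
     A = {b + c |b c. b \<in> B \<and> c \<in> C} \<and> B \<inter> C = {0}"

end

theory Submission
  imports Defs
begin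

text \<open>Let \<open>\<sigma>\<close> be the algebra automorphism with \<open>g \<mapsto> -g\<close>, \<open>x\<^sub>i \<mapsto> x\<^sub>i\<close>, and \<open>D\<^sub>i\<close> the right skew derivation
  \<open>D\<^sub>i(ab) = D\<^sub>i(a) \<sigma>(b) + a D\<^sub>i(b)\<close> with \<open>D\<^sub>i(g) = 0\<close>, \<open>D\<^sub>i(x\<^sub>j) = \<delta>\<^sub>i\<^sub>j g\<close>. It satisfies
  \<open>(id \<otimes> D\<^sub>i) \<Delta> = \<Delta> D\<^sub>i\<close>, so that \<open>y\<^sub>i = \<epsilon> D\<^sub>i\<close> gives \<open>(id \<otimes> y\<^sub>i) \<Delta> = D\<^sub>i\<close>. The \<open>D\<^sub>i\<close> anticommute, and
  together with the right multiplications by \<open>g x\<^sub>j\<close> they satisfy Clifford relations, which yields a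
  Poincare lemma: \<open>D\<^sub>i b = f\<^sub>i\<close> is solvable as soon as \<open>D\<^sub>i f\<^sub>j + D\<^sub>j f\<^sub>i = 0\<close>.

  For a cocycle \<open>z\<close> put \<open>f\<^sub>i = (id \<otimes> y\<^sub>i) z\<close>. Contracting the last leg of \<open>b\<^sup>2 z = 0\<close> with \<open>y\<^sub>i\<close> gives
  \<open>(id \<otimes> D\<^sub>i) z = \<Delta> f\<^sub>i - 1 \<otimes> f\<^sub>i\<close>, and hence \<open>D\<^sub>i f\<^sub>j + D\<^sub>j f\<^sub>i\<close> is the scalar
  \<open>(y\<^sub>i \<otimes> y\<^sub>j + y\<^sub>j \<otimes> y\<^sub>i) z\<close>. These scalars vanish on coboundaries and are coordinates on \<open>I\<close>, so the
  sum is direct and subtracting an element of \<open>I\<close> makes them vanish. Then \<open>f\<^sub>i = D\<^sub>i b\<close>, and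
  \<open>w = z + b\<^sup>1 b\<close> satisfies \<open>(id \<otimes> D\<^sub>i) w = 0\<close> for all \<open>i\<close>, which forces \<open>w = p \<otimes> 1 + q \<otimes> g\<close>.
  Contracting \<open>b\<^sup>2 w = 0\<close> with a functional that is \<open>1\<close> at \<open>1\<close> and \<open>0\<close> at \<open>g\<close> shows \<open>w = b\<^sup>1 p\<close>.\<close>

section \<open>Linear maps and tensors\<close>

lemma linearD:
  assumes "Vector_Spaces.linear s1 s2 f"
  shows "f (a + b) = f a + f b" "f (s1 c a) = s2 c (f a)" "f 0 = 0" "f (- a) = - f a"
    "f (a - b) = f a - f b" "f (sum h X) = (\<Sum>i\<in>X. f (h i))"
proof -
  interpret Vector_Spaces.linear s1 s2 f by (rule assms)
  show "f (a + b) = f a + f b" "f (s1 c a) = s2 c (f a)" "f 0 = 0" "f (- a) = - f a"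
    "f (a - b) = f a - f b" "f (sum h X) = (\<Sum>i\<in>X. f (h i))"
    by (rule add scale zero neg diff sum)+
qed

lemma linearI:
  assumes "vector_space s1" "vector_space s2"
    and "\<And>a b. f (a + b) = f a + f b" "\<And>c a. f (s1 c a) = s2 c (f a)"
  shows "Vector_Spaces.linear s1 s2 f"
  using assms by (auto intro!: Vector_Spaces.linear.intro module_hom.intro module_hom_axioms.intro
      simp: module_iff_vector_space)

text \<open>A scalar can be absorbed into the first leg of a pure tensor and \<open>0\<close> is
  itself pure, so pure tensors and sums suffice.\<close>

lemma (in tensor_product) tensor_induct [case_names pure add]:
  assumes pure: "\<And>v w. P (t v w)" and add: "\<And>y z. P y \<Longrightarrow> P z \<Longrightarrow> P (y + z)"
  shows "P z"
proof -
  have "z \<in> T.span {t v w |v w. True}" using span_range by blast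
  then show ?thesis
  proof (induction rule: T.span_induct_alt)
    case base
    have "t (sV 0 0) 0 = 0" unfolding bilinear_mapD(2)[OF bilinear] by simp
    then show ?case using pure by metis
  next
    case (step c y z)
    then obtain v w where "y = t v w" by blast
    then have "sT c y = t (sV c v) w" by (simp add: bilinear_mapD(2)[OF bilinear])
    then show ?case using step(2) pure add by simp
  qed
qed

section \<open>Subalgebras generated by anticommuting elements\<close>

context unital_algebra
begin

lemma scale_one_mult: "scale c 1 * a = scale c a" "a * scale c 1 = scale c a"
  by (simp_all flip: scale_mult_left scale_mult_right)

lemma generated_subalgebra_induct [consumes 1, case_names one gen add scale mult]:
  assumes "a \<in> generated_subalgebra scale X"
    and "P 1" "\<And>a. a \<in> X \<Longrightarrow> P a" "\<And>a b. P a \<Longrightarrow> P b \<Longrightarrow> P (a + b)"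
    "\<And>c a. P a \<Longrightarrow> P (scale c a)" "\<And>a b. P a \<Longrightarrow> P b \<Longrightarrow> P (a * b)"
  shows "P a"
proof -
  have "P (scale 0 1)" using assms(2,5) by blast
  then have "generated_subalgebra scale X \<subseteq> {a. P a}"
    unfolding generated_subalgebra_def subspace_def using assms(2-6)
    by (intro Inter_lower) auto
  then show ?thesis using assms(1) by blast
qed

lemma generated_subalgebra_closed:
  shows "subspace (generated_subalgebra scale X)"
    and "1 \<in> generated_subalgebra scale X"
    and "a \<in> X \<Longrightarrow> a \<in> generated_subalgebra scale X"
    and "a \<in> generated_subalgebra scale X \<Longrightarrow> b \<in> generated_subalgebra scale X \<Longrightarrow>
      a * b \<in> generated_subalgebra scale X"
  unfolding generated_subalgebra_def subspace_def by auto

lemma generated_subalgebra_least: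
  assumes "subspace A" "1 \<in> A" "\<And>a b. a \<in> A \<Longrightarrow> b \<in> A \<Longrightarrow> a * b \<in> A" "X \<subseteq> A"
  shows "generated_subalgebra scale X \<subseteq> A"
  using assms unfolding generated_subalgebra_def by blast

text \<open>Moving \<open>u\<close> past an element of the subalgebra \<open>A\<close> of
  \<open>X\<close> only replaces that element by another one of \<open>A\<close>, and
  \<open>u * u\<close> lies in \<open>A\<close>; hence \<open>A + A u\<close> is closed under
  products.\<close>

lemma generated_subalgebra_insert:
  assumes anti: "\<And>y. y \<in> X \<Longrightarrow> u * y = - (y * u)" and sq: "u * u \<in> {0, 1}"
  shows "generated_subalgebra scale (insert u X) =
    {a + b * u |a b. a \<in> generated_subalgebra scale X \<and> b \<in> generated_subalgebra scale X}"
    (is "?L = ?R")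
proof
  let ?A = "generated_subalgebra scale X"
  note A = generated_subalgebra_closed[where X = X]
  have swap: "\<exists>a'\<in>?A. u * a = a' * u" if "a \<in> ?A" for a
    using that
  proof (induction rule: generated_subalgebra_induct)
    case one
    then show ?case using A(2) by (intro bexI[of _ 1]) auto
  next
    case (gen a)
    then show ?case using anti A(3) subspace_neg[OF A(1)] by (intro bexI[of _ "- a"]) auto
  next
    case (add a b)
    then show ?case using subspace_add[OF A(1)] by (metis distrib_left distrib_right)
  next
    case (scale c a)
    then show ?case using subspace_scale[OF A(1)] by (metis scale_mult_left scale_mult_right)
  next
    case (mult a b)
    then show ?case using A(4) by (metis mult.assoc)
  qed
  have sqA: "u * u \<in> ?A" using sq subspace_0[OF A(1)] A(2) by auto
  show "?L \<subseteq> ?R"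
  proof (rule generated_subalgebra_least)
    show "subspace ?R"
      unfolding subspace_def
    proof (intro conjI ballI allI)
      show "0 \<in> ?R" using subspace_0[OF A(1)] by force
    next
      fix y z assume "y \<in> ?R" "z \<in> ?R"
      then obtain a b c d where *: "a \<in> ?A" "b \<in> ?A" "c \<in> ?A" "d \<in> ?A" "y = a + b * u" "z = c + d * u"
        by blast
      then have "y + z = (a + c) + (b + d) * u" by (simp add: algebra_simps)
      then show "y + z \<in> ?R" using * subspace_add[OF A(1)] by blast
    next
      fix c y assume "y \<in> ?R"
      then obtain a b where *: "a \<in> ?A" "b \<in> ?A" "y = a + b * u" by blast
      then have "scale c y = scale c a + scale c b * u"
        by (simp add: scale_right_distrib scale_mult_left)
      then show "scale c y \<in> ?R" using * subspace_scale[OF A(1)] by blast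
    qed
    show "1 \<in> ?R" using A(2) subspace_0[OF A(1)] by force
    show "insert u X \<subseteq> ?R"
    proof -
      have "u = 0 + 1 * u" "y = y + 0 * u" for y by simp_all
      then show ?thesis using A(2,3) subspace_0[OF A(1)] by blast
    qed
    fix y z assume "y \<in> ?R" "z \<in> ?R"
    then obtain a b c d where *: "a \<in> ?A" "b \<in> ?A" "c \<in> ?A" "d \<in> ?A" "y = a + b * u" "z = c + d * u"
      by blast
    obtain c' where c': "c' \<in> ?A" "u * c = c' * u" using swap *(3) by blast
    obtain d' where d': "d' \<in> ?A" "u * d = d' * u" using swap *(4) by blast
    have "y * z = a * c + a * d * u + b * (u * c) + b * (u * d) * u"
      unfolding * by (simp add: algebra_simps)
    also have "\<dots> = (a * c + b * d' * (u * u)) + (a * d + b * c') * u"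
      unfolding c' d' by (simp add: algebra_simps)
    finally have "y * z = (a * c + b * d' * (u * u)) + (a * d + b * c') * u" .
    moreover have "a * c + b * d' * (u * u) \<in> ?A" "a * d + b * c' \<in> ?A"
      by (intro subspace_add[OF A(1)] A(4) * c' d' sqA)+
    ultimately show "y * z \<in> ?R" by blast
  qed
  note L = generated_subalgebra_closed[where X = "insert u X"]
  have "?A \<subseteq> ?L"
    by (rule generated_subalgebra_least) (auto intro: L)
  then have "a + b * u \<in> ?L" if "a \<in> ?A" "b \<in> ?A" for a b
    using that subspace_add[OF L(1) _ L(4)[OF _ L(3)]] by (meson insertI1 subsetD)
  then show "?R \<subseteq> ?L" by blast
qed

lemma span_insert_generated:
  assumes anti: "\<And>y. y \<in> X \<Longrightarrow> u * y = - (y * u)" and sq: "u * u \<in> {0, 1}"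
    and S: "span S = generated_subalgebra scale X"
  shows "span (S \<union> (\<lambda>s. s * u) ` S) = generated_subalgebra scale (insert u X)"
proof -
  have "Vector_Spaces.linear scale scale (\<lambda>s. s * u)"
    by (rule linearI) (simp_all add: vector_space_axioms distrib_right scale_mult_left)
  then have "span ((\<lambda>s. s * u) ` S) = (\<lambda>s. s * u) ` span S"
    by (simp add: linear_def module_hom.span_image module_hom_eq_linear)
  moreover have "generated_subalgebra scale (insert u X) =
      {a + b * u |a b. a \<in> generated_subalgebra scale X \<and> b \<in> generated_subalgebra scale X}"
    using anti sq by (rule generated_subalgebra_insert)
  moreover have "{a + b |a b. a \<in> A \<and> b \<in> (\<lambda>s. s * u) ` A} = {a + b * u |a b. a \<in> A \<and> b \<in> A}" for A
    by auto
  ultimately show ?thesis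
    by (simp add: span_Un S)
qed

text \<open>Each new generator at most doubles the spanning set.\<close>

lemma generated_subalgebra_spanning_set:
  assumes "finite X" "\<And>a b. a \<in> X \<Longrightarrow> b \<in> X \<Longrightarrow> a \<noteq> b \<Longrightarrow> a * b = - (b * a)"
    "\<And>a. a \<in> X \<Longrightarrow> a * a \<in> {0, 1}"
  shows "\<exists>S. finite S \<and> card S \<le> 2 ^ card X \<and> span S = generated_subalgebra scale X"
  using assms
proof (induction X rule: finite_induct)
  case empty
  have "generated_subalgebra scale {} \<subseteq> span {1}"
  proof (rule generated_subalgebra_least)
    show "a * b \<in> span {1}" if "a \<in> span {1}" "b \<in> span {1}" for a b
      using that by (auto simp: span_singleton scale_one_mult)
  qed (auto simp: span_base)
  moreover have "span {1} \<subseteq> generated_subalgebra scale {}"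
    by (rule span_minimal) (auto intro: generated_subalgebra_closed)
  ultimately show ?case by (intro exI[of _ "{1}"]) auto
next
  case (insert u X)
  have "\<exists>S. finite S \<and> card S \<le> 2 ^ card X \<and> span S = generated_subalgebra scale X"
  proof (rule insert.IH)
    show "a * b = - (b * a)" if "a \<in> X" "b \<in> X" "a \<noteq> b" for a b
      using that(3) by (rule insert.prems(1)[OF insertI2[OF that(1)] insertI2[OF that(2)]])
    show "a * a \<in> {0, 1}" if "a \<in> X" for a
      by (rule insert.prems(2)[OF insertI2[OF that]])
  qed
  then obtain S where S: "finite S" "card S \<le> 2 ^ card X" "span S = generated_subalgebra scale X"
    by blast
  have "span (S \<union> (\<lambda>s. s * u) ` S) = generated_subalgebra scale (insert u X)"
  proof (rule span_insert_generated)
    show "u * y = - (y * u)" if "y \<in> X" for y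
      using that insert.hyps(2) by (intro insert.prems(1)) auto
    show "u * u \<in> {0, 1}" by (intro insert.prems(2)) simp
  qed (rule S(3))
  moreover have "card (S \<union> (\<lambda>s. s * u) ` S) \<le> 2 ^ card (insert u X)"
    using card_Un_le[of S "(\<lambda>s. s * u) ` S"] card_image_le[OF S(1), of "\<lambda>s. s * u"] S(2) insert(1,2)
    by simp
  ultimately show ?case using S(1) by (intro exI[of _ "S \<union> (\<lambda>s. s * u) ` S"]) simp
qed

text \<open>With \<open>A\<close> generated by \<open>X\<close>, the dimension forces the sum \<open>A + A u\<close> of the whole algebra to be
  direct and \<open>a \<mapsto> a u\<close> to be injective on \<open>A\<close>; this is how the dimension axiom replaces a normal form.\<close>

lemma linear_extension_insert:
  fixes F G :: "'a \<Rightarrow> 'a"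
  assumes fin: "finite X" and card: "card X \<le> m"
    and anti: "\<And>a b. a \<in> X \<Longrightarrow> b \<in> X \<Longrightarrow> a \<noteq> b \<Longrightarrow> a * b = - (b * a)"
    and anti_u: "\<And>y. y \<in> X \<Longrightarrow> u * y = - (y * u)"
    and sq: "\<And>a. a \<in> insert u X \<Longrightarrow> a * a \<in> {0, 1}"
    and gen: "generated_subalgebra scale (insert u X) = UNIV"
    and dim: "dim (UNIV :: 'a set) = 2 ^ (m + 1)"
    and F: "Vector_Spaces.linear scale scale F" and G: "Vector_Spaces.linear scale scale G"
  obtains D where "Vector_Spaces.linear scale scale D"
    "\<And>a. a \<in> generated_subalgebra scale X \<Longrightarrow> D a = F a"
    "\<And>a. a \<in> generated_subalgebra scale X \<Longrightarrow> D (a * u) = G a"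
proof -
  obtain S where S: "finite S" "card S \<le> 2 ^ card X" "span S = generated_subalgebra scale X"
    using generated_subalgebra_spanning_set[OF fin anti sq[OF insertI2]] by blast
  let ?T = "(\<lambda>s. s * u) ` S"
  have sp: "span (S \<union> ?T) = UNIV"
    unfolding gen[symmetric] using anti_u sq[OF insertI1] S(3) by (rule span_insert_generated)
  have finST: "finite (S \<union> ?T)" using S by simp
  have "card S \<le> 2 ^ m" using S(2) card by (meson le_trans one_le_numeral power_increasing)
  moreover have cT: "card ?T \<le> card S" using S(1) by (rule card_image_le)
  moreover have ST: "card (S \<union> ?T) + card (S \<inter> ?T) = card S + card ?T"
    using card_Un_Int[OF S(1) finite_imageI[OF S(1)], symmetric] .
  moreover have d: "2 ^ (m + 1) \<le> card (S \<union> ?T)"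
    using dim_le_card[of UNIV "S \<union> ?T"] sp dim finST by simp
  \<comment> \<open>At most \<open>2 ^ m\<close> elements in each half and at least
    \<open>2 ^ (m + 1)\<close> in the union leave no slack.\<close>
  ultimately have eq: "card ?T = card S" "card (S \<inter> ?T) = 0" "card (S \<union> ?T) = 2 ^ (m + 1)"
    by auto
  have inj: "inj_on (\<lambda>s. s * u) S" using eq_card_imp_inj_on[OF S(1) eq(1)] .
  have disj: "S \<inter> ?T = {}" using eq(2) S(1) by simp
  \<comment> \<open>A spanning set as large as the dimension is independent: dropping a redundant
    element would leave too few.\<close>
  have ind: "independent (S \<union> ?T)"
  proof
    assume "dependent (S \<union> ?T)"
    then obtain b where b: "b \<in> S \<union> ?T" "b \<in> span (S \<union> ?T - {b})" unfolding dependent_def by blast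
    then have "span (S \<union> ?T - {b}) = UNIV"
      using span_redundant[of b "S \<union> ?T - {b}"] sp by (simp add: insert_absorb)
    then have "2 ^ (m + 1) \<le> card (S \<union> ?T - {b})"
      using dim_le_card[of UNIV "S \<union> ?T - {b}"] finST dim by simp
    then show False using eq(3) card_Diff1_less[OF finST b(1)] by simp
  qed
  interpret P: vector_space_pair scale scale ..
  obtain D where D: "Vector_Spaces.linear scale scale D"
    "\<forall>y\<in>S \<union> ?T. D y = (if y \<in> S then F y else G (inv_into S (\<lambda>s. s * u) y))"
    using P.linear_independent_extend[OF ind,
        of "\<lambda>y. if y \<in> S then F y else G (inv_into S (\<lambda>s. s * u) y)"] by blast
  have Du: "Vector_Spaces.linear scale scale (\<lambda>a. D (a * u))"
    by (rule linearI) (simp_all add: vector_space_axioms distrib_right linearD[OF D(1)]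
        flip: scale_mult_left)
  show thesis
  proof
    fix a assume "a \<in> generated_subalgebra scale X"
    then have a: "a \<in> span S" using S by simp
    show "D a = F a"
      by (rule P.linear_eq_on_span[OF D(1) F _ a]) (use D(2) in auto)
    show "D (a * u) = G a"
      by (rule P.linear_eq_on_span[OF Du G _ a]) (use D(2) disj inv_into_f_f[OF inj] in auto)
  qed (rule D(1))
qed

end

section \<open>Skew derivations of \<open>E(n)\<close>\<close>

context E_hopf_algebra
begin

lemma H_induct [case_names one gen_g gen_x add scale mult]:
  assumes "P 1" "P g" "\<And>i. i \<in> {1..n} \<Longrightarrow> P (x i)" "\<And>a b. P a \<Longrightarrow> P b \<Longrightarrow> P (a + b)"
    "\<And>c a. P a \<Longrightarrow> P (sH c a)" "\<And>a b. P a \<Longrightarrow> P b \<Longrightarrow> P (a * b)"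
  shows "P h"
proof -
  have "h \<in> generated_subalgebra sH (insert g (x ` {1..n}))" unfolding generated by (rule UNIV_I)
  then show ?thesis
    by (induction rule: H.generated_subalgebra_induct) (use assms in auto)
qed

lemma g_g: "g * g = 1"
  using g_square by (simp add: power2_eq_square)

lemma x_sq: "i \<in> {1..n} \<Longrightarrow> x i * x i = 0"
  using x_square by (simp add: power2_eq_square)

lemma x_g: "i \<in> {1..n} \<Longrightarrow> x i * g = - (g * x i)"
  using g_x by simp

lemma anticomm:
  assumes "a \<in> insert g (x ` {1..n})" "b \<in> insert g (x ` {1..n})" "a \<noteq> b"
  shows "a * b = - (b * a)"
  using assms(1)
proof
  assume "a = g"
  then show ?thesis using assms g_x by auto
next
  assume "a \<in> x ` {1..n}"
  then obtain i where i: "i \<in> {1..n}" "a = x i" by blast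
  show ?thesis
    using assms(2) i x_g x_x[of i] by blast
qed

lemma squares: "a \<in> insert g (x ` {1..n}) \<Longrightarrow> a * a \<in> {0, 1}"
  using g_g x_sq by auto

text \<open>\<open>\<sigma>\<close> is the identity on the subalgebra \<open>?P\<close> of the
  \<open>x i\<close> and a sign change on \<open>?P g\<close>. Multiplicativity is an induction on
  the right factor with the left one arbitrary, so the decomposition is needed only for right
  multiplication by generators.\<close>

lemma exists_parity:
  obtains \<sigma> where "Vector_Spaces.linear sH sH \<sigma>" "\<And>a b. \<sigma> (a * b) = \<sigma> a * \<sigma> b"
    "\<sigma> g = - g" "\<And>i. i \<in> {1..n} \<Longrightarrow> \<sigma> (x i) = x i"
proof -
  let ?P = "generated_subalgebra sH (x ` {1..n})"
  note P = H.generated_subalgebra_closed[where X = "x ` {1..n}"]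
  have lin: "Vector_Spaces.linear sH sH (\<lambda>a. a)" "Vector_Spaces.linear sH sH (\<lambda>a. - (a * g))"
    by (auto intro!: linearI simp: H.vector_space_axioms distrib_right H.scale_mult_left)
  have anti: "g * y = - (y * g)" if "y \<in> x ` {1..n}" for y using that g_x by blast
  have fin: "finite (x ` {1..n})" by simp
  have card: "card (x ` {1..n}) \<le> n" using card_image_le[of "{1..n}" x] by simp
  have anti': "a * b = - (b * a)" if "a \<in> x ` {1..n}" "b \<in> x ` {1..n}" "a \<noteq> b" for a b
    using that by (intro anticomm) blast+
  obtain \<sigma> where \<sigma>: "Vector_Spaces.linear sH sH \<sigma>" "\<And>a. a \<in> ?P \<Longrightarrow> \<sigma> a = a"
    "\<And>a. a \<in> ?P \<Longrightarrow> \<sigma> (a * g) = - (a * g)"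
    using H.linear_extension_insert[OF fin card anti' anti squares generated dimension lin] by blast
  have H: "\<exists>p q. p \<in> ?P \<and> q \<in> ?P \<and> a = p + q * g" for a
  proof -
    have "a \<in> generated_subalgebra sH (insert g (x ` {1..n}))" unfolding generated by (rule UNIV_I)
    then show ?thesis
      using H.generated_subalgebra_insert[OF anti squares[of g]] by blast
  qed
  note \<sigma>' = \<sigma>(2,3) linearD[OF \<sigma>(1)]
  have \<sigma>g: "\<sigma> g = - g" using \<sigma>(3)[of 1] P(2) by simp
  have \<sigma>x: "\<sigma> (x i) = x i" if "i \<in> {1..n}" for i using \<sigma>(2) P(3) that by auto
  have \<sigma>1: "\<sigma> 1 = 1" using \<sigma>(2) P(2) by auto
  have "\<forall>a. \<sigma> (a * b) = \<sigma> a * \<sigma> b" for b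
  proof (induction b rule: H_induct)
    case gen_g
    show ?case
    proof
      fix a
      obtain p q where pq: "p \<in> ?P" "q \<in> ?P" "a = p + q * g" using H by blast
      then have "a * g = q + p * g" by (simp add: algebra_simps g_g)
      then show "\<sigma> (a * g) = \<sigma> a * \<sigma> g"
        using pq by (simp add: \<sigma>' \<sigma>g algebra_simps g_g)
    qed
  next
    case (gen_x i)
    show ?case
    proof
      fix a
      obtain p q where pq: "p \<in> ?P" "q \<in> ?P" "a = p + q * g" using H by blast
      then have eq: "a * x i = p * x i - (q * x i) * g"
        by (simp add: algebra_simps g_x[OF gen_x])
      have "p * x i \<in> ?P" "q * x i \<in> ?P" using pq P(3,4) gen_x by auto
      then have "\<sigma> (a * x i) = p * x i + (q * x i) * g"
        unfolding eq by (simp add: \<sigma>')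
      moreover have "\<sigma> a * \<sigma> (x i) = (p - q * g) * x i"
        using pq by (simp add: \<sigma>' \<sigma>x[OF gen_x])
      ultimately show "\<sigma> (a * x i) = \<sigma> a * \<sigma> (x i)"
        by (simp add: algebra_simps g_x[OF gen_x])
    qed
  qed (auto simp: \<sigma>1 linearD[OF \<sigma>(1)] distrib_left simp flip: H.scale_mult_right mult.assoc)
  then show thesis using that \<sigma>(1) \<sigma>g \<sigma>x by blast
qed

text \<open>Here \<open>?P\<close> is generated by \<open>g\<close> and the \<open>x j\<close> with
  \<open>j \<noteq> i\<close>; \<open>D\<close> is \<open>0\<close> on \<open>?P\<close> and sends
  \<open>p * x i\<close> to \<open>p * g\<close>. The Leibniz rule is again an induction on the
  right factor.\<close>

lemma exists_skew_derivation:
  assumes \<sigma>: "Vector_Spaces.linear sH sH \<sigma>" "\<And>a b. \<sigma> (a * b) = \<sigma> a * \<sigma> b"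
    "\<sigma> g = - g" "\<And>i. i \<in> {1..n} \<Longrightarrow> \<sigma> (x i) = x i"
    and i: "i \<in> {1..n}"
  obtains D where "Vector_Spaces.linear sH sH D" "\<And>a b. D (a * b) = D a * \<sigma> b + a * D b"
    "D g = 0" "\<And>j. j \<in> {1..n} \<Longrightarrow> D (x j) = (if i = j then g else 0)"
proof -
  let ?X = "insert g (x ` ({1..n} - {i}))"
  let ?P = "generated_subalgebra sH ?X"
  note P = H.generated_subalgebra_closed[where X = ?X]
  have lin: "Vector_Spaces.linear sH sH (\<lambda>a. 0)" "Vector_Spaces.linear sH sH (\<lambda>a. a * g)"
    by (auto intro!: linearI simp: H.vector_space_axioms distrib_right H.scale_mult_left)
  have anti: "x i * y = - (y * x i)" if "y \<in> ?X" for y using that i x_x[OF i] x_g[OF i] by blast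
  have gen: "generated_subalgebra sH (insert (x i) ?X) = UNIV"
  proof -
    have "insert (x i) ?X = insert g (x ` {1..n})" using i by auto
    then show ?thesis using generated by metis
  qed
  have "card ?X \<le> Suc (card (x ` ({1..n} - {i})))" by (rule card_insert_le_m1) auto
  also have "\<dots> \<le> Suc (card ({1..n} - {i}))" by (simp add: card_image_le)
  also have "\<dots> = n" using i by simp
  finally have card: "card ?X \<le> n" .
  have anti': "a * b = - (b * a)" if "a \<in> ?X" "b \<in> ?X" "a \<noteq> b" for a b
    using that by (intro anticomm) blast+
  have sq: "a * a \<in> {0, 1}" if "a \<in> insert (x i) ?X" for a
    using that i by (intro squares) blast
  have fin: "finite ?X" by simp
  obtain D where D: "Vector_Spaces.linear sH sH D" "\<And>a. a \<in> ?P \<Longrightarrow> D a = 0"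
    "\<And>a. a \<in> ?P \<Longrightarrow> D (a * x i) = a * g"
    using H.linear_extension_insert[OF fin card anti' anti sq gen dimension lin] by blast
  have H: "\<exists>p q. p \<in> ?P \<and> q \<in> ?P \<and> a = p + q * x i" for a
  proof -
    have "a \<in> generated_subalgebra sH (insert (x i) ?X)" unfolding gen by (rule UNIV_I)
    then show ?thesis
      using H.generated_subalgebra_insert[OF anti squares[of "x i"]] i by blast
  qed
  note D' = D(2,3) linearD[OF D(1)]
  have \<sigma>1: "\<sigma> 1 = 1" using \<sigma>(2)[of g g] \<sigma>(3) g_g by simp
  have Dg: "D g = 0" using D(2) P(3) by auto
  have D1: "D 1 = 0" using D(2) P(2) by auto
  have Dx: "D (x j) = (if i = j then g else 0)" if "j \<in> {1..n}" for j
    using D(2)[of "x j"] D(3)[of 1] P(2) P(3)[of "x j"] that by auto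
  have "\<forall>a. D (a * b) = D a * \<sigma> b + a * D b" for b
  proof (induction b rule: H_induct)
    case gen_g
    show ?case
    proof
      fix a
      obtain p q where pq: "p \<in> ?P" "q \<in> ?P" "a = p + q * x i" using H by blast
      then have eq: "a * g = p * g - (q * g) * x i" by (simp add: algebra_simps g_x[OF i])
      have "p * g \<in> ?P" "q * g \<in> ?P" using pq P(3,4) by auto
      then have "D (a * g) = - (q * g * g)"
        unfolding eq by (simp add: D')
      moreover have "D a = q * g" using pq by (simp add: D')
      ultimately show "D (a * g) = D a * \<sigma> g + a * D g"
        by (simp add: \<sigma>(3) Dg)
    qed
  next
    case (gen_x j)
    show ?case
    proof
      fix a
      obtain p q where pq: "p \<in> ?P" "q \<in> ?P" "a = p + q * x i" using H by blast
      then have Da: "D a = q * g" by (simp add: D')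
      show "D (a * x j) = D a * \<sigma> (x j) + a * D (x j)"
      proof (cases "i = j")
        case True
        have "a * x i = p * x i" using pq by (simp add: algebra_simps x_sq[OF i])
        then have "D (a * x i) = p * g" using pq by (simp add: D')
        moreover have "D (x i) = g" using Dx[OF i] by simp
        ultimately show ?thesis
          using Da pq(3) \<sigma>(4)[OF i] by (simp add: True[symmetric] algebra_simps g_x[OF i])
      next
        case False
        have eq: "a * x j = p * x j - (q * x j) * x i"
          using pq by (simp add: algebra_simps x_x[OF i gen_x])
        have "p * x j \<in> ?P" "q * x j \<in> ?P" using pq P(3,4) gen_x False by auto
        then have "D (a * x j) = - (q * x j * g)"
          unfolding eq by (simp add: D')
        moreover have "D (x j) = 0" using Dx[OF gen_x] False by simp
        ultimately show ?thesis
          using Da \<sigma>(4)[OF gen_x] by (simp add: algebra_simps g_x[OF gen_x])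
      qed
    qed
  next
    case (add b c)
    then show ?case by (simp add: linearD[OF D(1)] linearD[OF \<sigma>(1)] algebra_simps)
  next
    case (scale c b)
    then show ?case
      by (simp add: linearD[OF D(1)] linearD[OF \<sigma>(1)] H.scale_right_distrib flip: H.scale_mult_right)
  next
    case (mult b c)
    show ?case
    proof
      fix a
      have "D (a * (b * c)) = D (a * b) * \<sigma> c + (a * b) * D c" using mult(2) by (metis mult.assoc)
      also have "\<dots> = D a * \<sigma> (b * c) + a * D (b * c)"
        using mult by (simp add: \<sigma>(2) algebra_simps)
      finally show "D (a * (b * c)) = D a * \<sigma> (b * c) + a * D (b * c)" .
    qed
  qed (simp add: \<sigma>1 D1)
  then show thesis using that D(1) Dg Dx by blast
qed

end

text \<open>Fixes one choice of the maps constructed above, so that later definitions can refer to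
  them.\<close>

locale E_skew_derivations = E_hopf_algebra sH sHH sHHH tt ttt \<Delta> \<epsilon> S n g x
  for sH :: "'k::field \<Rightarrow> 'h::ring_1 \<Rightarrow> 'h"
  and sHH :: "'k \<Rightarrow> 'hh::ring_1 \<Rightarrow> 'hh"
  and sHHH :: "'k \<Rightarrow> 'hhh::ab_group_add \<Rightarrow> 'hhh"
  and tt :: "'h \<Rightarrow> 'h \<Rightarrow> 'hh"
  and ttt :: "'hh \<Rightarrow> 'h \<Rightarrow> 'hhh"
  and \<Delta> :: "'h \<Rightarrow> 'hh" and \<epsilon> :: "'h \<Rightarrow> 'k" and S :: "'h \<Rightarrow> 'h"
  and n :: nat and g :: 'h and x :: "nat \<Rightarrow> 'h" +
  fixes \<sigma> :: "'h \<Rightarrow> 'h" and D :: "nat \<Rightarrow> 'h \<Rightarrow> 'h"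
  assumes two_neq_0: "(2::'k) \<noteq> 0"
    and \<sigma>_linear: "Vector_Spaces.linear sH sH \<sigma>"
    and \<sigma>_mult: "\<sigma> (a * b) = \<sigma> a * \<sigma> b"
    and \<sigma>_g: "\<sigma> g = - g"
    and \<sigma>_x: "i \<in> {1..n} \<Longrightarrow> \<sigma> (x i) = x i"
    and D_linear: "i \<in> {1..n} \<Longrightarrow> Vector_Spaces.linear sH sH (D i)"
    and D_mult: "i \<in> {1..n} \<Longrightarrow> D i (a * b) = D i a * \<sigma> b + a * D i b"
    and D_g: "i \<in> {1..n} \<Longrightarrow> D i g = 0"
    and D_x: "i \<in> {1..n} \<Longrightarrow> j \<in> {1..n} \<Longrightarrow> D i (x j) = (if i = j then g else 0)"

lemma (in E_hopf_algebra) exists_skew_derivations: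
  assumes "(2::'k) \<noteq> 0"
  obtains \<sigma> D where "E_skew_derivations sH sHH sHHH tt ttt \<Delta> \<epsilon> S n g x \<sigma> D"
proof -
  obtain \<sigma> where \<sigma>: "Vector_Spaces.linear sH sH \<sigma>" "\<And>a b. \<sigma> (a * b) = \<sigma> a * \<sigma> b"
    "\<sigma> g = - g" "\<And>i. i \<in> {1..n} \<Longrightarrow> \<sigma> (x i) = x i"
    using exists_parity by blast
  define Q where "Q i D \<longleftrightarrow> Vector_Spaces.linear sH sH D \<and> (\<forall>a b. D (a * b) = D a * \<sigma> b + a * D b) \<and>
      D g = 0 \<and> (\<forall>j\<in>{1..n}. D (x j) = (if i = j then g else 0))" for i D
  have "\<exists>D. Q i D" if "i \<in> {1..n}" for i
    by (rule exists_skew_derivation[OF \<sigma> that]) (auto simp: Q_def)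
  then obtain D where D: "\<And>i. i \<in> {1..n} \<Longrightarrow> Q i (D i)"
    by metis
  have D': "Vector_Spaces.linear sH sH (D i)" "D i (a * b) = D i a * \<sigma> b + a * D i b"
    "D i g = 0" "j \<in> {1..n} \<Longrightarrow> D i (x j) = (if i = j then g else 0)" if "i \<in> {1..n}" for i j a b
    using D[OF that] unfolding Q_def by blast+
  have "E_skew_derivations sH sHH sHHH tt ttt \<Delta> \<epsilon> S n g x \<sigma> D"
    using assms \<sigma> D'
    by (intro E_skew_derivations.intro E_hopf_algebra_axioms E_skew_derivations_axioms.intro)
  then show thesis by (rule that)
qed

section \<open>Contractions of tensors\<close>

context algebra_tensor_powers
begin

text \<open>For linear arguments \<open>map_right f\<close> is \<open>id \<otimes> f\<close>, and
  \<open>contract \<phi>\<close> is \<open>id \<otimes> \<phi>\<close> with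
  \<open>H \<otimes> k\<close> identified with \<open>H\<close>; \<open>contract3\<close> does the
  same on the last leg of a triple tensor.\<close>

definition map_right :: "('h \<Rightarrow> 'h) \<Rightarrow> 'hh \<Rightarrow> 'hh" where
  "map_right f = tensor_lift sHH sHH tt (\<lambda>a b. tt a (f b))"

definition contract :: "('h \<Rightarrow> 'k) \<Rightarrow> 'hh \<Rightarrow> 'h" where
  "contract \<phi> = tensor_lift sHH sH tt (\<lambda>a b. sH (\<phi> b) a)"

definition contract3 :: "('h \<Rightarrow> 'k) \<Rightarrow> 'hhh \<Rightarrow> 'hh" where
  "contract3 \<phi> = tensor_lift sHHH sHH ttt (\<lambda>w b. sHH (\<phi> b) w)"

lemma
  assumes "Vector_Spaces.linear sH sH f"
  shows map_right_linear: "Vector_Spaces.linear sHH sHH (map_right f)"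
    and map_right_tt: "map_right f (tt a b) = tt a (f b)"
proof -
  have *: "bilinear_map sH sH sHH (\<lambda>a b. tt a (f b))"
    by (rule bilinear_mapI)
      (simp_all add: H.vector_space_axioms HH.vector_space_axioms tt_simps linearD[OF assms])
  show "Vector_Spaces.linear sHH sHH (map_right f)" "map_right f (tt a b) = tt a (f b)"
    unfolding map_right_def
    by (rule T2.linear_tensor_lift[OF HH.vector_space_axioms *]
        T2.tensor_lift_apply[OF HH.vector_space_axioms *])+
qed

lemma
  assumes "Vector_Spaces.linear sH (*) \<phi>"
  shows contract_linear: "Vector_Spaces.linear sHH sH (contract \<phi>)"
    and contract_tt: "contract \<phi> (tt a b) = sH (\<phi> b) a"
proof -
  have *: "bilinear_map sH sH sH (\<lambda>a b. sH (\<phi> b) a)"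
    by (rule bilinear_mapI)
      (simp_all add: H.vector_space_axioms linearD[OF assms] H.scale_right_distrib
        H.scale_left_distrib mult.commute)
  show "Vector_Spaces.linear sHH sH (contract \<phi>)" "contract \<phi> (tt a b) = sH (\<phi> b) a"
    unfolding contract_def
    by (rule T2.linear_tensor_lift[OF H.vector_space_axioms *]
        T2.tensor_lift_apply[OF H.vector_space_axioms *])+
qed

lemma
  assumes "Vector_Spaces.linear sH (*) \<phi>"
  shows contract3_linear: "Vector_Spaces.linear sHHH sHH (contract3 \<phi>)"
    and contract3_ttt: "contract3 \<phi> (ttt w b) = sHH (\<phi> b) w"
proof -
  have *: "bilinear_map sHH sH sHH (\<lambda>w b. sHH (\<phi> b) w)"
    by (rule bilinear_mapI)
      (simp_all add: H.vector_space_axioms HH.vector_space_axioms linearD[OF assms]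
        HH.scale_right_distrib HH.scale_left_distrib mult.commute)
  show "Vector_Spaces.linear sHHH sHH (contract3 \<phi>)" "contract3 \<phi> (ttt w b) = sHH (\<phi> b) w"
    unfolding contract3_def
    by (rule T3.linear_tensor_lift[OF HH.vector_space_axioms *]
        T3.tensor_lift_apply[OF HH.vector_space_axioms *])+
qed

lemma contract3_ttt_left:
  assumes "Vector_Spaces.linear sH (*) \<phi>"
  shows "contract3 \<phi> (ttt_left a w) = tt a (contract \<phi> w)"
proof (induction w rule: T2.tensor_induct)
  case (pure u v)
  show ?case by (simp add: contract3_ttt[OF assms] contract_tt[OF assms] tt_simps)
next
  case (add u v)
  then show ?case
    by (simp add: linearD[OF ttt_left_linear] linearD[OF contract3_linear[OF assms]]
        linearD[OF contract_linear[OF assms]] tt_simps)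
qed

end

context bialgebra
begin

lemma b1_linear: "Vector_Spaces.linear sH sHH b1"
  by (rule linearI) (simp_all add: H.vector_space_axioms HH.vector_space_axioms b1_def tt_simps
      linearD[OF comult_linear] HH.scale_right_distrib HH.scale_right_diff_distrib)

text \<open>The contraction meets a comultiplied leg only in \<open>a \<otimes> \<Delta> b\<close>,
  where the hypothesis on \<open>f\<close> applies.\<close>

lemma contract3_b2:
  assumes \<phi>: "Vector_Spaces.linear sH (*) \<phi>"
    and f: "Vector_Spaces.linear sH sH f" "\<And>h. contract \<phi> (\<Delta> h) = f h"
  shows "contract3 \<phi> (b2 z) =
    tt 1 (contract \<phi> z) - \<Delta> (contract \<phi> z) + map_right f z - sHH (\<phi> 1) z"
proof (induction z rule: T2.tensor_induct)
  case (pure a b)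
  show ?case
    by (simp add: b2_tt linearD[OF contract3_linear[OF \<phi>]] contract3_ttt[OF \<phi>]
        contract3_ttt_left[OF \<phi>] contract_tt[OF \<phi>] f(2) map_right_tt[OF f(1)] tt_simps
        linearD[OF comult_linear])
next
  case (add y z)
  then show ?case
    by (simp add: linearD[OF b2_linear] linearD[OF contract3_linear[OF \<phi>]]
        linearD[OF contract_linear[OF \<phi>]] linearD[OF map_right_linear[OF f(1)]]
        linearD[OF comult_linear] tt_simps HH.scale_right_distrib)
qed

text \<open>Coassociativity cancels the two middle terms of \<open>b2 (\<Delta> a)\<close>; what is
  left cancels against \<open>b2 (1 \<otimes> a)\<close> and
  \<open>b2 (a \<otimes> 1)\<close>.\<close>

lemma b2_b1: "b2 (b1 a) = 0"
proof -
  let ?l = "tensor_lift sHH sHHH tt (\<lambda>a b. ttt (\<Delta> a) b)"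
  let ?r = "tensor_lift sHH sHHH tt (\<lambda>a b. ttt_left a (\<Delta> b))"
  have l: "bilinear_map sH sH sHHH (\<lambda>a b. ttt (\<Delta> a) b)"
    by (rule bilinear_mapI) (simp_all add: H.vector_space_axioms T3.T.vector_space_axioms
        ttt_simps linearD[OF comult_linear])
  have r: "bilinear_map sH sH sHHH (\<lambda>a b. ttt_left a (\<Delta> b))"
    by (rule bilinear_mapI) (simp_all add: H.vector_space_axioms T3.T.vector_space_axioms
        bilinear_mapD[OF ttt_left_bilinear] linearD[OF comult_linear])
  note l' = T2.tensor_lift[OF T3.T.vector_space_axioms l]
  note r' = T2.tensor_lift[OF T3.T.vector_space_axioms r]
  have "b2 w = ttt_left 1 w - ?l w + ?r w - ttt w 1" for w
    by (induction w rule: T2.tensor_induct)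
      (simp_all add: b2_tt l'(2) r'(2) linearD[OF b2_linear] linearD[OF l'(1)] linearD[OF r'(1)]
        linearD[OF ttt_left_linear] ttt_simps)
  then have "b2 (\<Delta> a) = ttt_left 1 (\<Delta> a) - ttt (\<Delta> a) 1"
    using coassoc[of a] by simp
  then show ?thesis
    by (simp add: b1_def linearD[OF b2_linear] b2_tt comult_one ttt_left_tt flip: tt_one)
qed

end

section \<open>The cohomology of \<open>E(n)\<close>\<close>

context E_skew_derivations
begin

section \<open>Clifford relations and the Poincare lemma\<close>

lemma \<sigma>_1: "\<sigma> 1 = 1"
  using \<sigma>_mult[of g g] \<sigma>_g g_g by simp

lemma D_1: "i \<in> {1..n} \<Longrightarrow> D i 1 = 0"
  using D_mult[of i g g] D_g[of i] g_g by simp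

text \<open>The sign comes from \<open>D i (x i) = g\<close> and
  \<open>\<sigma> g = - g\<close>.\<close>

lemma D_\<sigma>:
  assumes i: "i \<in> {1..n}"
  shows "D i (\<sigma> h) = - \<sigma> (D i h)"
proof (induction h rule: H_induct)
  case (gen_x j)
  then show ?case using i by (simp add: \<sigma>_x D_x \<sigma>_g linearD[OF \<sigma>_linear])
qed (use i in \<open>simp_all add: \<sigma>_1 \<sigma>_g \<sigma>_mult D_1 D_g D_mult
  linearD[OF \<sigma>_linear] linearD[OF D_linear]\<close>)

text \<open>By the sign in \<open>D_\<sigma>\<close> the mixed terms of the two composites are
  opposite, so the claim passes to products.\<close>

lemma D_anticommute:
  assumes i: "i \<in> {1..n}" and j: "j \<in> {1..n}"
  shows "D i (D j h) = - D j (D i h)"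
proof (induction h rule: H_induct)
  case (gen_x k)
  then show ?case using i j by (simp add: D_x D_g linearD(3)[OF D_linear])
next
  case (mult a b)
  have "D i (D j (a * b)) = D i (D j a) * \<sigma> (\<sigma> b) - D j a * \<sigma> (D i b) +
      D i a * \<sigma> (D j b) + a * D i (D j b)"
    using i j by (simp add: D_mult linearD(1)[OF D_linear] D_\<sigma>)
  moreover have "D j (D i (a * b)) = D j (D i a) * \<sigma> (\<sigma> b) - D i a * \<sigma> (D j b) +
      D j a * \<sigma> (D i b) + a * D j (D i b)"
    using i j by (simp add: D_mult linearD(1)[OF D_linear] D_\<sigma>)
  ultimately show ?case by (simp add: mult)
qed (simp_all add: D_1[OF i] D_1[OF j] D_g[OF i] D_g[OF j] linearD[OF D_linear[OF i]]
  linearD[OF D_linear[OF j]])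

text \<open>The assumption on the characteristic is used here and for the functional in
  \<open>cocycle_group_part\<close>.\<close>

lemma eq_neg_imp_0:
  assumes "a = - a" shows "a = (0::'h)"
proof -
  have "sH 2 a = a + a" using H.scale_left_distrib[of 1 1 a] by simp
  then have "sH 2 a = 0" using assms by (metis add.right_inverse)
  then show ?thesis using two_neq_0 by simp
qed

lemma D_D: "i \<in> {1..n} \<Longrightarrow> D i (D i h) = 0"
  using D_anticommute eq_neg_imp_0 by blast

text \<open>A Clifford relation: right multiplication by \<open>g * x j\<close> is a contracting
  homotopy for \<open>D i\<close> if \<open>i = j\<close> and anticommutes with it
  otherwise.\<close>

lemma D_gx_right:
  assumes i: "i \<in> {1..n}" and j: "j \<in> {1..n}"
  shows "D i (h * (g * x j)) = (if i = j then h else 0) - D i h * (g * x j)"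
  using assms by (simp add: D_mult D_g D_x \<sigma>_mult \<sigma>_g \<sigma>_x g_g)

lemma poincare:
  assumes "finite K" "K \<subseteq> {1..n}" "\<And>i j. i \<in> K \<Longrightarrow> j \<in> K \<Longrightarrow> D i (f j) = - D j (f i)"
  shows "\<exists>b. \<forall>i\<in>K. D i b = f i"
  using assms
proof (induction K rule: finite_induct)
  case (insert m K)
  have m: "m \<in> {1..n}" and K: "K \<subseteq> {1..n}" using insert.prems(1) by auto
  have "\<exists>b. \<forall>i\<in>K. D i b = f i"
    by (rule insert.IH[OF K insert.prems(2)]) simp_all
  then obtain b where b: "\<And>i. i \<in> K \<Longrightarrow> D i b = f i" by blast
  \<comment> \<open>The defect \<open>r\<close> is killed by \<open>D i\<close> for all
    \<open>i\<close> in \<open>insert m K\<close>, so adding \<open>r * (g * x m)\<close> to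
    \<open>b\<close> repairs the equation for \<open>m\<close> and keeps the others.\<close>
  define r where "r = f m - D m b"
  have fm: "D m (f m) = 0"
    using insert.prems(2)[of m m] eq_neg_imp_0 by blast
  have Dm: "D m r = 0"
    by (simp add: r_def linearD[OF D_linear[OF m]] fm D_D[OF m])
  have Di: "D i r = 0" if "i \<in> K" for i
  proof -
    have i: "i \<in> {1..n}" using that K by blast
    have "D i r = D i (f m) + D m (D i b)"
      by (simp add: r_def linearD[OF D_linear[OF i]] D_anticommute[OF i m])
    then show ?thesis using insert.prems(2)[of i m] that b[OF that] by simp
  qed
  show ?case
  proof (intro exI ballI)
    fix i assume i: "i \<in> insert m K"
    then have i': "i \<in> {1..n}" using m K by blast
    show "D i (b + r * (g * x m)) = f i"
      using i Dm Di b insert.hyps(2)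
      by (auto simp: linearD(1)[OF D_linear[OF i']] D_gx_right[OF i' m] r_def)
  qed
qed simp

section \<open>Compatibility of the skew derivations with the comultiplication\<close>

lemma map_right_mult:
  assumes "i \<in> {1..n}"
  shows "map_right (D i) (u * v) = map_right (D i) u * map_right \<sigma> v + u * map_right (D i) v"
proof (induction u rule: T2.tensor_induct)
  case (pure a b)
  show ?case
  proof (induction v rule: T2.tensor_induct)
    case (pure c d)
    show ?case
      by (simp add: tt_mult map_right_tt[OF D_linear[OF assms]] map_right_tt[OF \<sigma>_linear]
          D_mult[OF assms] tt_simps)
  qed (simp add: distrib_left linearD(1)[OF map_right_linear[OF D_linear[OF assms]]]
      linearD(1)[OF map_right_linear[OF \<sigma>_linear]])
qed (simp add: distrib_right linearD(1)[OF map_right_linear[OF D_linear[OF assms]]])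

lemma map_right_\<sigma>_mult: "map_right \<sigma> (u * v) = map_right \<sigma> u * map_right \<sigma> v"
proof (induction u rule: T2.tensor_induct)
  case (pure a b)
  show ?case
    by (induction v rule: T2.tensor_induct)
      (simp_all add: tt_mult map_right_tt[OF \<sigma>_linear] \<sigma>_mult distrib_left
        linearD(1)[OF map_right_linear[OF \<sigma>_linear]])
qed (simp add: distrib_right linearD(1)[OF map_right_linear[OF \<sigma>_linear]])

lemma tt_minus: "tt a (- b) = - tt a b" "tt a 0 = 0"
proof -
  interpret L: Vector_Spaces.linear sH sHH "tt a"
    using T2.bilinear unfolding bilinear_map_def by blast
  show "tt a (- b) = - tt a b" "tt a 0 = 0" by (rule L.neg L.zero)+
qed

lemma comult_\<sigma>: "map_right \<sigma> (\<Delta> h) = \<Delta> (\<sigma> h)"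
proof (induction h rule: H_induct)
  case one
  show ?case by (simp add: comult_one \<sigma>_1 map_right_tt[OF \<sigma>_linear] flip: tt_one)
next
  case (gen_x i)
  then show ?case
    by (simp add: comult_x \<sigma>_x \<sigma>_1 map_right_tt[OF \<sigma>_linear]
        linearD[OF map_right_linear[OF \<sigma>_linear]])
qed (simp_all add: comult_g \<sigma>_g \<sigma>_mult comult_mult map_right_\<sigma>_mult
  linearD[OF comult_linear] linearD[OF \<sigma>_linear] map_right_tt[OF \<sigma>_linear]
  linearD[OF map_right_linear[OF \<sigma>_linear]] tt_minus)

text \<open>Both sides obey the same twisted Leibniz rule, by \<open>map_right_mult\<close> and
  \<open>comult_\<sigma>\<close>, so generators decide; at \<open>x i\<close> both are
  \<open>g \<otimes> g\<close>.\<close>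

lemma comult_D:
  assumes i: "i \<in> {1..n}"
  shows "map_right (D i) (\<Delta> h) = \<Delta> (D i h)"
proof (induction h rule: H_induct)
  case one
  show ?case
    by (simp add: comult_one D_1[OF i] map_right_tt[OF D_linear[OF i]] tt_minus
        linearD[OF comult_linear] flip: tt_one)
next
  case (gen_x j)
  then show ?case
    by (simp add: comult_x comult_g D_x[OF i] D_1[OF i] map_right_tt[OF D_linear[OF i]] tt_minus
        linearD[OF comult_linear] linearD[OF map_right_linear[OF D_linear[OF i]]])
qed (simp_all add: comult_g D_g[OF i] D_mult[OF i] comult_mult map_right_mult[OF i] comult_\<sigma>
  linearD[OF comult_linear] linearD[OF D_linear[OF i]] map_right_tt[OF D_linear[OF i]]
  linearD[OF map_right_linear[OF D_linear[OF i]]] tt_minus)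

section \<open>Coordinate functionals and the contracted cocycle equation\<close>

definition coord :: "nat \<Rightarrow> 'h \<Rightarrow> 'k" where
  "coord i h = \<epsilon> (D i h)"

lemma coord_linear: "i \<in> {1..n} \<Longrightarrow> Vector_Spaces.linear sH (*) (coord i)"
  by (rule linearI)
    (simp_all add: H.vector_space_axioms vector_space_field coord_def linearD[OF D_linear]
      linearD[OF counit_linear])

lemma contract_coord:
  assumes i: "i \<in> {1..n}"
  shows "contract (coord i) z = contract \<epsilon> (map_right (D i) z)"
  by (induction z rule: T2.tensor_induct)
    (simp_all add: contract_tt[OF coord_linear[OF i]] contract_tt[OF counit_linear]
      map_right_tt[OF D_linear[OF i]] linearD(1)[OF contract_linear[OF coord_linear[OF i]]]
      linearD(1)[OF contract_linear[OF counit_linear]]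
      linearD(1)[OF map_right_linear[OF D_linear[OF i]]], simp add: coord_def)

text \<open>By \<open>comult_D\<close> the left side is
  \<open>(id \<otimes> \<epsilon>) (\<Delta> (D i h))\<close>, and the counit law applies.\<close>

lemma contract_coord_comult: "i \<in> {1..n} \<Longrightarrow> contract (coord i) (\<Delta> h) = D i h"
  using counit_right[of "D i h"] by (simp add: contract_coord comult_D flip: contract_def)

text \<open>This is \<open>contract3_b2\<close> for \<open>coord i\<close>; since
  \<open>coord i 1 = 0\<close>, the multiple of \<open>z\<close> drops out.\<close>

lemma cocycle_map_right_D:
  assumes i: "i \<in> {1..n}" and z: "z \<in> Z2"
  shows "map_right (D i) z = \<Delta> (contract (coord i) z) - tt 1 (contract (coord i) z)"
proof -
  have "contract3 (coord i) (b2 z) = 0"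
    using z by (simp add: Z2_def linearD(3)[OF contract3_linear[OF coord_linear[OF i]]])
  moreover have "coord i 1 = 0" by (simp add: coord_def D_1[OF i] linearD(3)[OF counit_linear])
  ultimately show ?thesis
    using contract3_b2[OF coord_linear[OF i] D_linear[OF i] contract_coord_comult[OF i], of z]
    by (simp add: algebra_simps)
qed

text \<open>Obtained by contracting \<open>cocycle_map_right_D\<close> with \<open>coord j\<close>.
  The last summand is skew in \<open>i\<close> and \<open>j\<close>, so symmetrizing leaves only
  scalars.\<close>

lemma D_contract_coord:
  assumes i: "i \<in> {1..n}" and j: "j \<in> {1..n}" and z: "z \<in> Z2"
  shows "D j (contract (coord i) z) =
    sH (coord j (contract (coord i) z)) 1 + contract \<epsilon> (map_right (D j) (map_right (D i) z))"
proof -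
  let ?h = "contract (coord i) z"
  have "contract (coord j) (map_right (D i) z) = D j ?h - contract (coord j) (tt 1 ?h)"
    by (simp add: cocycle_map_right_D[OF i z] linearD[OF contract_linear[OF coord_linear[OF j]]]
        contract_coord_comult[OF j])
  then show ?thesis
    by (simp add: contract_coord[OF j, of "map_right (D i) z"] contract_tt[OF coord_linear[OF j]])
qed

lemma map_right_D_anticommute:
  assumes i: "i \<in> {1..n}" and j: "j \<in> {1..n}"
  shows "map_right (D j) (map_right (D i) z) = - map_right (D i) (map_right (D j) z)"
  by (induction z rule: T2.tensor_induct)
    (simp_all add: map_right_tt[OF D_linear[OF i]] map_right_tt[OF D_linear[OF j]]
      linearD(1)[OF map_right_linear[OF D_linear[OF i]]]
      linearD(1)[OF map_right_linear[OF D_linear[OF j]]] D_anticommute[OF j i] tt_minus)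


section \<open>Tensors killed by all skew derivations\<close>

text \<open>Applying the projections \<open>h \<mapsto> D\<^sub>m (h g x\<^sub>m)\<close> one after the other shrinks this space from the whole
  algebra (\<open>K = {}\<close>) to the span of \<open>1\<close> and \<open>g\<close>.\<close>

definition residual_space :: "nat set \<Rightarrow> 'h set" where
  "residual_space K = H.span ({1, g} \<union> {h * x j |h j. j \<in> {1..n} - K})"

text \<open>The span contains \<open>1\<close> and is closed under right multiplication:
  \<open>c * x i\<close> is a spanning element for every \<open>c\<close>, while \<open>g\<close>
  swaps \<open>1\<close> and \<open>g\<close> and moves past each \<open>x j\<close>.\<close>

lemma residual_space_empty: "residual_space {} = UNIV"
proof -
  let ?G = "{1, g} \<union> {h * x j |h j. j \<in> {1..n} - {}}"
  have step: "a * b \<in> H.span ?G" if "\<And>c. c \<in> ?G \<Longrightarrow> c * b \<in> H.span ?G" "a \<in> H.span ?G" for a b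
    using that(2)
  proof (induction rule: H.span_induct_alt)
    case (step c y z)
    then show ?case
      using that(1) by (simp add: distrib_right H.span_add H.span_scale flip: H.scale_mult_left)
  qed (simp add: H.span_zero)
  have closed: "\<forall>a\<in>H.span ?G. a * b \<in> H.span ?G" for b
  proof (induction b rule: H_induct)
    case gen_g
    have "c * g \<in> H.span ?G" if c: "c \<in> ?G" for c
    proof -
      consider "c = 1" | "c = g" | h j where "c = h * x j" "j \<in> {1..n}" using c by blast
      then show ?thesis
      proof cases
        case 3
        then have "c * g = (- h * g) * x j" by (simp add: mult.assoc g_x)
        then show ?thesis using 3 by (intro H.span_base) blast
      qed (simp_all add: g_g H.span_base)
    qed
    then show ?case using step by blast
  next
    case (gen_x i)
    have "c * x i \<in> H.span ?G" for c
      using gen_x by (intro H.span_base) blast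
    then show ?case by blast
  next
    case (add b c)
    then show ?case by (simp add: distrib_left H.span_add)
  next
    case (scale c b)
    then show ?case by (simp add: H.span_scale flip: H.scale_mult_right)
  next
    case (mult b c)
    then show ?case by (simp flip: mult.assoc)
  qed simp
  have "1 \<in> H.span ?G" by (rule H.span_base) simp
  then have "b \<in> H.span ?G" for b using bspec[OF closed, of 1 b] by simp
  then show ?thesis unfolding residual_space_def by blast
qed

text \<open>The projection fixes \<open>1\<close> and \<open>g\<close>, kills left multiples of
  \<open>x m\<close>, and preserves left multiples of the other \<open>x j\<close>, because
  \<open>x j\<close> commutes with \<open>g * x m\<close>.\<close>

lemma D_gx_residual:
  assumes m: "m \<in> {1..n}" and v: "v \<in> residual_space K"
  shows "D m (v * (g * x m)) \<in> residual_space (insert m K)"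
  using v unfolding residual_space_def
proof (induction rule: H.span_induct_alt)
  case base
  then show ?case by (simp add: linearD(3)[OF D_linear[OF m]] H.span_zero)
next
  case (step c y z)
  let ?G = "{1, g} \<union> {h * x j |h j. j \<in> {1..n} - insert m K}"
  have "D m (y * (g * x m)) \<in> H.span ?G"
  proof -
    consider "y = 1" | "y = g" | h where "y = h * x m" | h j where "y = h * x j" "j \<in> {1..n} - insert m K"
      using step(1) by blast
    then show ?thesis
    proof cases
      case 1
      then show ?thesis using D_gx_right[OF m m, of 1] by (simp add: D_1[OF m] H.span_base)
    next
      case (3 h)
      have "x m * (g * x m) = - (g * (x m * x m))" by (simp add: x_g[OF m] flip: mult.assoc)
      then have "y * (g * x m) = 0" using 3 by (simp add: mult.assoc x_sq[OF m])
      then show ?thesis by (simp add: linearD(3)[OF D_linear[OF m]] H.span_zero)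
    next
      case (4 h j)
      then have j: "j \<in> {1..n}" "m \<noteq> j" by auto
      have "D m y = D m h * x j" using 4 by (simp add: D_mult[OF m] D_x[OF m j(1)] \<sigma>_x[OF j(1)] j(2))
      moreover have "x j * (g * x m) = g * x m * x j"
        by (simp add: x_g[OF j(1)] x_x[OF j(1) m] mult.assoc flip: mult.assoc[of "x j"])
      moreover have "D m (y * (g * x m)) = y - D m y * (g * x m)"
        by (simp add: D_gx_right[OF m m])
      ultimately have "D m (y * (g * x m)) = (h - D m h * (g * x m)) * x j"
        using 4(1) by (simp add: left_diff_distrib mult.assoc)
      then show ?thesis using 4(2) by (auto intro!: H.span_base)
    qed (simp add: D_gx_right[OF m m] D_g[OF m] H.span_base)
  qed
  then show ?case
    using step(2) by (simp add: distrib_right linearD[OF D_linear[OF m]] H.span_add H.span_scale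
        flip: H.scale_mult_left)
qed

text \<open>By the homotopy relation, a tensor killed by \<open>id \<otimes> D m\<close> is fixed by
  the projection \<open>h \<mapsto> D m (h * (g * x m))\<close> on the right leg, so its right legs
  can be moved into the next residual space.\<close>

lemma map_right_D_eq_0:
  assumes "finite K" "K \<subseteq> {1..n}" "\<And>i. i \<in> K \<Longrightarrow> map_right (D i) z = 0"
  shows "z \<in> HH.span {tt a v |a v. v \<in> residual_space K}"
  using assms
proof (induction K rule: finite_induct)
  case empty
  then show ?case using T2.span_range by (simp add: residual_space_empty)
next
  case (insert m K)
  have m: "m \<in> {1..n}" using insert.prems by blast
  define f where "f h = h * (g * x m)" for h
  have f: "Vector_Spaces.linear sH sH f"
    by (rule linearI) (simp_all add: H.vector_space_axioms f_def distrib_right H.scale_mult_left)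
  have Df: "Vector_Spaces.linear sH sH (\<lambda>h. D m (f h))"
    by (rule linearI) (simp_all add: H.vector_space_axioms linearD[OF f] linearD[OF D_linear[OF m]])
  have "map_right (\<lambda>h. D m (f h)) w = w - map_right f (map_right (D m) w)" for w
  proof (induction w rule: T2.tensor_induct)
    case (pure a b)
    show ?case
      by (simp add: map_right_tt[OF Df] map_right_tt[OF f] map_right_tt[OF D_linear[OF m]])
        (simp add: f_def D_gx_right[OF m m] tt_simps tt_minus diff_conv_add_uminus
          del: add_uminus_conv_diff)
  qed (simp add: linearD(1)[OF map_right_linear[OF Df]] linearD(1)[OF map_right_linear[OF f]]
      linearD(1)[OF map_right_linear[OF D_linear[OF m]]])
  then have z: "map_right (\<lambda>h. D m (f h)) z = z"
    using insert.prems(2)[of m] by (simp add: linearD(3)[OF map_right_linear[OF f]])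
  have "z \<in> HH.span {tt a v |a v. v \<in> residual_space K}"
    using insert.prems by (intro insert.IH) auto
  then have "map_right (\<lambda>h. D m (f h)) z \<in> HH.span {tt a v |a v. v \<in> residual_space (insert m K)}"
  proof (induction rule: HH.span_induct_alt)
    case base
    then show ?case by (simp add: linearD(3)[OF map_right_linear[OF Df]] HH.span_zero)
  next
    case (step c w y)
    then obtain a v where av: "w = tt a v" "v \<in> residual_space K" by blast
    have "map_right (\<lambda>h. D m (f h)) w \<in> HH.span {tt a v |a v. v \<in> residual_space (insert m K)}"
      unfolding av(1) map_right_tt[OF Df] using D_gx_residual[OF m av(2)]
      by (intro HH.span_base) (auto simp: f_def)
    then show ?case
      using step(2) by (simp add: linearD[OF map_right_linear[OF Df]] HH.span_add HH.span_scale)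
  qed
  then show ?case by (simp add: z)
qed

lemma map_right_D_eq_0_obtain:
  assumes "\<And>i. i \<in> {1..n} \<Longrightarrow> map_right (D i) z = 0"
  obtains p q where "z = tt p 1 + tt q g"
proof -
  have "z \<in> HH.span {tt a v |a v. v \<in> residual_space {1..n}}"
    using assms by (intro map_right_D_eq_0) auto
  moreover have "residual_space {1..n} = H.span {1, g}" by (simp add: residual_space_def)
  ultimately have "z \<in> HH.span {tt a v |a v. v \<in> H.span {1, g}}" by simp
  then have "\<exists>p q. z = tt p 1 + tt q g"
  proof (induction rule: HH.span_induct_alt)
    case base
    have "0 = tt 0 1 + tt 0 g" using tt_simps(2)[of 0 0] by simp
    then show ?case by blast
  next
    case (step c w y)
    then obtain p q a v where *: "y = tt p 1 + tt q g" "w = tt a v" "v \<in> H.span {1, g}" by blast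
    then obtain d e where "v = sH d 1 + sH e g"
      by (auto simp: H.span_breakdown_eq algebra_simps)
    then have "sHH c w + y = tt (sH c (sH d a) + p) 1 + tt (sH c (sH e a) + q) g"
      unfolding * by (simp add: tt_simps HH.scale_right_distrib algebra_simps)
    then show ?case by blast
  qed
  then show thesis using that by blast
qed

text \<open>The map \<open>f\<close> fixes \<open>1\<close> and kills \<open>g\<close>, so the
  contracted cocycle equation reads
  \<open>1 \<otimes> p - \<Delta> p + p \<otimes> 1 - z = 0\<close>.\<close>

lemma cocycle_group_part:
  assumes z: "z \<in> Z2" and pq: "z = tt p 1 + tt q g"
  shows "z = b1 p"
proof -
  \<comment> \<open>Since \<open>\<epsilon> (\<sigma> g) = - 1\<close>, averaging
    \<open>\<epsilon>\<close> and \<open>\<epsilon> \<circ> \<sigma>\<close> gives \<open>1\<close>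
    at \<open>1\<close> and \<open>0\<close> at \<open>g\<close>.\<close>
  define \<phi> where "\<phi> h = (\<epsilon> h + \<epsilon> (\<sigma> h)) / 2" for h
  define f where "f h = contract \<phi> (\<Delta> h)" for h
  have \<phi>: "Vector_Spaces.linear sH (*) \<phi>"
    by (rule linearI) (simp_all add: H.vector_space_axioms vector_space_field \<phi>_def
        linearD[OF counit_linear] linearD[OF \<sigma>_linear] add_divide_distrib distrib_left)
  have f: "Vector_Spaces.linear sH sH f"
    by (rule linearI) (simp_all add: H.vector_space_axioms f_def
        linearD[OF contract_linear[OF \<phi>]] linearD[OF comult_linear])
  have \<phi>1: "\<phi> 1 = 1" and \<phi>g: "\<phi> g = 0"
    using two_neq_0 by (simp_all add: \<phi>_def \<sigma>_1 \<sigma>_g linearD[OF counit_linear] counit_one counit_g)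
  have f1: "f 1 = 1" and fg: "f g = 0"
    by (simp_all add: f_def comult_one comult_g contract_tt[OF \<phi>] \<phi>1 \<phi>g flip: tt_one)
  have "contract \<phi> z = p"
    by (simp add: pq linearD[OF contract_linear[OF \<phi>]] contract_tt[OF \<phi>] \<phi>1 \<phi>g)
  moreover have "map_right f z = tt p 1"
    by (simp add: pq linearD[OF map_right_linear[OF f]] map_right_tt[OF f] f1 fg tt_minus)
  moreover have "contract3 \<phi> (b2 z) = 0"
    using z by (simp add: Z2_def linearD(3)[OF contract3_linear[OF \<phi>]])
  ultimately show ?thesis
    using contract3_b2[OF \<phi> f f_def[symmetric], of z] by (simp add: \<phi>1 b1_def)
qed

section \<open>The projection onto the span of the \<open>g * x i \<otimes> x l\<close>\<close>

definition coord2 :: "nat \<Rightarrow> nat \<Rightarrow> 'hh \<Rightarrow> 'k" where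
  "coord2 i j z = coord i (contract (coord j) z)"

text \<open>On the diagonal, \<open>coord2 i i\<close> is not doubled: the functionals are dual to the generators of \<open>I2\<close>.\<close>

definition sym_coord :: "nat \<Rightarrow> nat \<Rightarrow> 'hh \<Rightarrow> 'k" where
  "sym_coord i j z = (if i = j then coord2 i i z else coord2 i j z + coord2 j i z)"

definition index_pairs :: "(nat \<times> nat) set" where
  "index_pairs = {(i, j). 1 \<le> i \<and> i \<le> j \<and> j \<le> n}"

text \<open>Restricted to cocycles, this turns out to be the projection onto \<open>I2\<close> along
  \<open>B2\<close>.\<close>

definition proj :: "'hh \<Rightarrow> 'hh" where
  "proj z = (\<Sum>(i, j)\<in>index_pairs. sHH (sym_coord i j z) (tt (g * x i) (x j)))"

lemma index_pairsD: "(i, j) \<in> index_pairs \<Longrightarrow> i \<in> {1..n} \<and> j \<in> {1..n} \<and> i \<le> j"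
  unfolding index_pairs_def by auto

lemma finite_index_pairs: "finite index_pairs"
  by (rule finite_subset[of _ "{1..n} \<times> {1..n}"]) (auto simp: index_pairs_def)

lemma I2_alt: "I2 = HH.span {tt (g * x i) (x j) |i j. (i, j) \<in> index_pairs}"
  by (simp add: I2_def index_pairs_def)

lemma coord2_linear:
  assumes "i \<in> {1..n}" "j \<in> {1..n}"
  shows "Vector_Spaces.linear sHH (*) (coord2 i j)"
  by (rule linearI)
    (simp_all add: HH.vector_space_axioms vector_space_field coord2_def
      linearD[OF coord_linear[OF assms(1)]] linearD[OF contract_linear[OF coord_linear[OF assms(2)]]])

text \<open>\<open>coord2 i j\<close> is \<open>y\<^sub>i \<otimes> y\<^sub>j\<close>; duality holds
  because \<open>D l (x l) = g\<close> and \<open>D k (g * x k) = g * g = 1\<close> both have counit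
  \<open>1\<close>.\<close>

lemma coord2_gx_x:
  assumes "i \<in> {1..n}" "j \<in> {1..n}" "k \<in> {1..n}" "l \<in> {1..n}"
  shows "coord2 i j (tt (g * x k) (x l)) = (if (i, j) = (k, l) then 1 else 0)"
proof -
  have "coord j (x l) = (if j = l then 1 else 0)"
    using assms by (simp add: coord_def D_x counit_g linearD(3)[OF counit_linear])
  moreover have "coord i (g * x k) = (if i = k then 1 else 0)"
    using assms by (simp add: coord_def D_mult D_g D_x g_g counit_one linearD(3)[OF counit_linear])
  ultimately show ?thesis
    using assms by (simp add: coord2_def contract_tt[OF coord_linear] linearD(2)[OF coord_linear])
qed

lemma sym_coord_linear:
  assumes "i \<in> {1..n}" "j \<in> {1..n}"
  shows "Vector_Spaces.linear sHH (*) (sym_coord i j)"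
  by (rule linearI)
    (simp_all add: HH.vector_space_axioms vector_space_field sym_coord_def distrib_left
      linearD[OF coord2_linear[OF assms]] linearD[OF coord2_linear[OF assms(2,1)]]
      linearD[OF coord2_linear[OF assms(2,2)]])

lemma proj_linear: "Vector_Spaces.linear sHH sHH proj"
proof (rule linearI)
  note lin = linearD[OF sym_coord_linear]
  show "proj (a + b) = proj a + proj b" for a b
    unfolding proj_def sum.distrib[symmetric]
    by (rule sum.cong) (auto dest!: index_pairsD simp: lin HH.scale_left_distrib)
  show "proj (sHH c a) = sHH c (proj a)" for c a
    unfolding proj_def HH.scale_sum_right
    by (rule sum.cong) (auto dest!: index_pairsD simp: lin)
qed (rule HH.vector_space_axioms)+

lemma proj_in_I2: "proj z \<in> I2"
  unfolding proj_def I2_alt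
proof (rule HH.span_sum, clarify)
  fix i j assume "(i, j) \<in> index_pairs"
  then show "sHH (sym_coord i j z) (tt (g * x i) (x j)) \<in>
      HH.span {tt (g * x i) (x j) |i j. (i, j) \<in> index_pairs}"
    by (intro HH.span_scale HH.span_base) blast
qed

lemma proj_gx_x:
  assumes "(k, l) \<in> index_pairs"
  shows "proj (tt (g * x k) (x l)) = tt (g * x k) (x l)"
proof -
  have "proj (tt (g * x k) (x l)) =
      (\<Sum>ij\<in>index_pairs. if ij = (k, l) then tt (g * x k) (x l) else 0)"
    unfolding proj_def
  proof (rule sum.cong[OF refl], clarify)
    fix i j assume "(i, j) \<in> index_pairs"
    then show "sHH (sym_coord i j (tt (g * x k) (x l))) (tt (g * x i) (x j)) =
        (if (i, j) = (k, l) then tt (g * x k) (x l) else 0)"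
      using assms[THEN index_pairsD] by (auto dest!: index_pairsD simp: sym_coord_def coord2_gx_x)
  qed
  then show ?thesis using assms finite_index_pairs by simp
qed

lemma proj_I2: "w \<in> I2 \<Longrightarrow> proj w = w"
  unfolding I2_alt
  by (induction rule: HH.span_induct_alt)
    (auto simp: linearD[OF proj_linear] proj_gx_x)

text \<open>No generator of \<open>I2\<close> has \<open>i > j\<close>, so the whole symmetrized
  coordinate sits at the ordered pair; \<open>z\<close> and \<open>proj z\<close> thus have equal
  symmetrized coordinates.\<close>

lemma coord2_proj:
  assumes i: "i \<in> {1..n}" and j: "j \<in> {1..n}"
  shows "coord2 i j (proj z) = (if i \<le> j then sym_coord i j z else 0)"
proof -
  have "coord2 i j (proj z) = (\<Sum>kl\<in>index_pairs. if kl = (i, j) then sym_coord i j z else 0)"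
    unfolding proj_def linearD(6)[OF coord2_linear[OF assms]]
    by (rule sum.cong)
      (auto dest!: index_pairsD simp: linearD(2)[OF coord2_linear[OF assms]] coord2_gx_x[OF assms]
        split: if_splits)
  also have "\<dots> = (if i \<le> j then sym_coord i j z else 0)"
    using assms finite_index_pairs by (simp add: index_pairs_def)
  finally show ?thesis .
qed

text \<open>On \<open>b1 a\<close> the value of \<open>coord2 k l\<close> is
  \<open>- \<epsilon> (D k (D l a))\<close>, which is alternating since the \<open>D i\<close>
  anticommute and square to zero.\<close>

lemma sym_coord_b1:
  assumes i: "i \<in> {1..n}" and j: "j \<in> {1..n}"
  shows "sym_coord i j (b1 a) = 0"
proof -
  have c1: "coord k 1 = 0" if "k \<in> {1..n}" for k
    using that by (simp add: coord_def D_1 linearD(3)[OF counit_linear])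
  have "coord2 k l (b1 a) = - \<epsilon> (D k (D l a))" if "k \<in> {1..n}" "l \<in> {1..n}" for k l
    using that
    by (simp add: coord2_def b1_def linearD[OF contract_linear[OF coord_linear[of l]]]
        contract_tt[OF coord_linear[of l]] contract_coord_comult c1 linearD[OF coord_linear[of k]])
      (simp add: coord_def)
  then show ?thesis
    using i j D_anticommute[OF i j]
    by (simp add: sym_coord_def D_D linearD[OF counit_linear])
qed

lemma proj_b1: "proj (b1 a) = 0"
  unfolding proj_def
  by (rule sum.neutral) (auto dest!: index_pairsD simp: sym_coord_b1)

text \<open>As \<open>\<Delta> (g * x i) = g * x i \<otimes> g + 1 \<otimes> g * x i\<close>, the
  six terms cancel in pairs.\<close>

lemma gx_x_cocycle:
  assumes "i \<in> {1..n}" "j \<in> {1..n}"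
  shows "b2 (tt (g * x i) (x j)) = 0"
  using assms
  by (simp add: b2_tt comult_mult comult_g comult_x distrib_left tt_mult g_g tt_simps ttt_simps
      linearD(1)[OF ttt_left_linear])

lemma I2_subset_Z2: "I2 \<subseteq> Z2"
proof
  fix w assume "w \<in> I2"
  then have "b2 w = 0"
    unfolding I2_alt
    by (induction rule: HH.span_induct_alt)
      (auto dest!: index_pairsD simp: linearD[OF b2_linear] gx_x_cocycle)
  then show "w \<in> Z2" by (simp add: Z2_def)
qed

section \<open>Splitting of the cocycles\<close>

lemma cocycle_coboundary:
  assumes z: "z \<in> Z2"
    and skew: "\<And>i j. i \<in> {1..n} \<Longrightarrow> j \<in> {1..n} \<Longrightarrow> coord2 i j z = - coord2 j i z"
  shows "z \<in> B2"
proof -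
  define f where "f i = contract (coord i) z" for i
  have "D i (f j) = - D j (f i)" if i: "i \<in> {1..n}" and j: "j \<in> {1..n}" for i j
  proof -
    have "D i (f j) = sH (coord2 i j z) 1 + contract \<epsilon> (map_right (D i) (map_right (D j) z))"
      unfolding f_def coord2_def by (rule D_contract_coord[OF j i z])
    also have "\<dots> = - (sH (coord2 j i z) 1 + contract \<epsilon> (map_right (D j) (map_right (D i) z)))"
      by (simp add: skew[OF i j] map_right_D_anticommute[OF j i, of z]
          linearD[OF contract_linear[OF counit_linear]])
    also have "\<dots> = - D j (f i)"
      unfolding f_def coord2_def by (simp only: D_contract_coord[OF i j z])
    finally show ?thesis .
  qed
  then obtain b where b: "\<And>i. i \<in> {1..n} \<Longrightarrow> D i b = f i"
    using poincare[of "{1..n}" f] by blast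
  \<comment> \<open>The sign is plus because contracting \<open>b1 b\<close> with
    \<open>coord i\<close> gives a scalar minus \<open>D i b\<close>. Hence \<open>f i\<close>
    cancels, and a scalar contraction makes the right side of \<open>cocycle_map_right_D\<close>
    vanish.\<close>
  define w where "w = z + b1 b"
  have w: "w \<in> Z2"
    using z by (simp add: w_def Z2_def linearD[OF b2_linear] b2_b1)
  have "map_right (D i) w = 0" if i: "i \<in> {1..n}" for i
  proof -
    have "coord i 1 = 0" by (simp add: coord_def D_1[OF i] linearD(3)[OF counit_linear])
    then have "contract (coord i) w = sH (coord i b) 1"
      using b[OF i] by (simp add: w_def b1_def linearD[OF contract_linear[OF coord_linear[OF i]]]
          contract_tt[OF coord_linear[OF i]] contract_coord_comult[OF i] f_def)
    then show ?thesis
      by (simp add: cocycle_map_right_D[OF i w] linearD[OF comult_linear] comult_one tt_simps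
          flip: tt_one)
  qed
  then obtain p q where "w = tt p 1 + tt q g" using map_right_D_eq_0_obtain by blast
  then have "z = b1 (p - b)"
    using cocycle_group_part[OF w] by (simp add: w_def linearD[OF b1_linear] algebra_simps)
  then show ?thesis by (simp add: B2_def)
qed

lemma Z2_direct_sum: "internal_direct_sum sHH Z2 B2 I2"
  unfolding internal_direct_sum_def
proof (intro conjI)
  show "HH.subspace B2"
    unfolding HH.subspace_def B2_def using linearD(1-3)[OF b1_linear]
    by (auto simp: image_iff) metis+
  show "HH.subspace I2" by (simp add: I2_def)
  show "Z2 = {b + c |b c. b \<in> B2 \<and> c \<in> I2}"
  proof
    show "Z2 \<subseteq> {b + c |b c. b \<in> B2 \<and> c \<in> I2}"
    proof
      fix z assume z: "z \<in> Z2"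
      have "z - proj z \<in> Z2"
        using z I2_subset_Z2 proj_in_I2[of z] by (auto simp: Z2_def linearD[OF b2_linear])
      \<comment> \<open>Subtracting \<open>proj z\<close> removes the symmetric part of the
        coordinates.\<close>
      moreover have "coord2 i j (z - proj z) = - coord2 j i (z - proj z)"
        if "i \<in> {1..n}" "j \<in> {1..n}" for i j
        using that by (simp add: linearD[OF coord2_linear] coord2_proj sym_coord_def)
      ultimately have "z - proj z \<in> B2" by (rule cocycle_coboundary)
      moreover have "z = (z - proj z) + proj z" by simp
      ultimately show "z \<in> {b + c |b c. b \<in> B2 \<and> c \<in> I2}" using proj_in_I2 by blast
    qed
    show "{b + c |b c. b \<in> B2 \<and> c \<in> I2} \<subseteq> Z2"
      using I2_subset_Z2 by (auto simp: Z2_def B2_def b2_b1 linearD[OF b2_linear])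
  qed
  \<comment> \<open>\<open>proj\<close> is the identity on \<open>I2\<close> and zero on
    \<open>B2\<close>.\<close>
  have "w = 0" if "w \<in> B2" "w \<in> I2" for w
    using that proj_I2[of w] proj_b1 by (auto simp: B2_def)
  moreover have "0 \<in> B2" using linearD(3)[OF b1_linear] unfolding B2_def by (metis rangeI)
  moreover have "0 \<in> I2" by (simp add: I2_def HH.span_zero)
  ultimately show "B2 \<inter> I2 = {0}" by blast
qed

end

theorem theorem4p18:
  fixes sH :: "'k::field \<Rightarrow> 'h::ring_1 \<Rightarrow> 'h"
    and sHH :: "'k \<Rightarrow> 'hh::ring_1 \<Rightarrow> 'hh"
    and sHHH :: "'k \<Rightarrow> 'hhh::ab_group_add \<Rightarrow> 'hhh"
    and tt :: "'h \<Rightarrow> 'h \<Rightarrow> 'hh"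
    and ttt :: "'hh \<Rightarrow> 'h \<Rightarrow> 'hhh"
    and \<Delta> :: "'h \<Rightarrow> 'hh" and \<epsilon> :: "'h \<Rightarrow> 'k" and S :: "'h \<Rightarrow> 'h"
    and n :: nat and g :: 'h and x :: "nat \<Rightarrow> 'h"
  assumes "CHAR('k) \<noteq> 2"
    and "n \<ge> 1"
    and "E_hopf_algebra sH sHH sHHH tt ttt \<Delta> \<epsilon> S n g x"
  shows "internal_direct_sum sHH
    (bialgebra.Z2 sHH sHHH tt ttt \<Delta>)
    (bialgebra.B2 tt \<Delta>)
    (E_hopf_algebra.I2 sHH tt n g x)"
proof -
  \<comment> \<open>The characteristic of a field is not \<open>1\<close>, so dividing the prime
    \<open>2\<close> would force it to be \<open>2\<close>.\<close>
  have "\<not> CHAR('k) dvd 2"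
    using assms(1) CHAR_not_1'[where 'a = 'k] by (metis One_nat_def prime_nat_iff two_is_prime_nat)
  then have "(2::'k) \<noteq> 0"
    using of_nat_eq_0_iff_char_dvd[of 2, where 'a = 'k] by simp
  then obtain \<sigma> D where "E_skew_derivations sH sHH sHHH tt ttt \<Delta> \<epsilon> S n g x \<sigma> D"
    using E_hopf_algebra.exists_skew_derivations[OF assms(3)] by blast
  then show ?thesis by (rule E_skew_derivations.Z2_direct_sum)
qed

end
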